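(* Let $\{X_i\}_{i\in I}$ be a family of Banach spaces such that for every $i \in I$ and for any collection of finitely many SSD-points of $X_i^*$, the intersection of their kernels is a strongly proximinal subspace of $X_i$. Let $X=\bigoplus_{c_0}X_i$ be the $c_0$-direct sum of the family. Then for any collection of finitely many SSD-points of $X^*$, the intersection of their kernels is a strongly proximinal subspace of $X$.
   Context: All Banach spaces are over $\mathbb{R}$ and all subspaces are closed. $B_V$ denotes the closed unit ball of a Banach space $V$. $\bigoplus_{c_0}X_i$ denotes the $c_0$-direct sum of $\{X_i:i\in I\}$ (families $(x_i)$ with $x_i \in X_i$ such that $\{i:\|x_i\|\ge\varepsilon\}$ is finite for every $\varepsilon>0$), equipped with the supremum norm. A vector $v$ in a Banach space $V$ is an SSD-point (point of strong subdifferentiability) of $V$ if the one-sided limit $\lim_{t\to 0^+}\frac{\|v+th\|-\|v\|}{t}$ exists uniformly for $h\in B_V$. For a subspace $Y$ of a Banach space $V$ and $x\in V$, let $P_Y(x)=\{y\in Y: d(x,Y)=\|x-y\|\}$. $Y$ is proximinal in $V$ if $P_Y(x)\neq\emptyset$ for all $x\notin Y$. A proximinal subspace $Y$ is strongly proximinal in $V$ if, for any $x\notin Y$ and any sequence $\{y_n\}_{n\ge 1}$ in $Y$ with $\lim_n\|x-y_n\|=d(x,Y)$, there are a subsequence $\{y_{n_k}\}$ and a sequence $\{z_k\}_{k\ge1}$ in $P_Y(x)$ such that $\|y_{n_k}-z_k\|\to 0$. *)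

theory Defs
  imports "HOL-Analysis.Analysis" "HOL-Library.Function_Algebras"
begin

text \<open>Functions form a real vector space under the pointwise operations; dual spaces and
  \<open>c\<^sub>0\<close>-sums are subspaces of such function spaces.\<close>

instantiation "fun" :: (type, real_vector) real_vector
begin

definition scaleR_fun :: "real \<Rightarrow> ('a \<Rightarrow> 'b) \<Rightarrow> 'a \<Rightarrow> 'b" where
  "scaleR_fun c f = (\<lambda>x. c *\<^sub>R f x)"

instance
  by standard (simp_all add: scaleR_fun_def fun_eq_iff scaleR_add_right scaleR_add_left)

end

text \<open>A family of Banach spaces cannot be indexed by types, so a normed space is a linear subspace
  of an ambient real vector space type together with its own norm.  The ambient type carries no
  norm or topology, and different spaces over it have unrelated norms; an arbitrary family of
  Banach spaces is of this form inside the algebraic direct sum of its members.  Values of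
  the norm outside the subspace are irrelevant.\<close>

datatype 'a nspace = NSpace (vecs: "'a set") (nrm: "'a \<Rightarrow> real")

definition normed_space :: "'a::real_vector nspace \<Rightarrow> bool" where
  "normed_space V \<longleftrightarrow>
     subspace (vecs V) \<and>
     (\<forall>x\<in>vecs V. 0 \<le> nrm V x \<and> (nrm V x = 0 \<longleftrightarrow> x = 0)) \<and>
     (\<forall>x\<in>vecs V. \<forall>c. nrm V (c *\<^sub>R x) = \<bar>c\<bar> * nrm V x) \<and>
     (\<forall>x\<in>vecs V. \<forall>y\<in>vecs V. nrm V (x + y) \<le> nrm V x + nrm V y)"

definition banach_space :: "'a::real_vector nspace \<Rightarrow> bool" where
  "banach_space V \<longleftrightarrow>
     normed_space V \<and>
     (\<forall>s::nat \<Rightarrow> 'a.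
        (\<forall>n. s n \<in> vecs V) \<and> (\<forall>e>0. \<exists>M. \<forall>m\<ge>M. \<forall>n\<ge>M. nrm V (s m - s n) < e) \<longrightarrow>
        (\<exists>x\<in>vecs V. (\<lambda>n. nrm V (s n - x)) \<longlonglongrightarrow> 0))"

definition unit_ball :: "'a nspace \<Rightarrow> 'a set" where
  "unit_ball V = {x \<in> vecs V. nrm V x \<le> 1}"

definition closed_subspace :: "'a::real_vector set \<Rightarrow> 'a nspace \<Rightarrow> bool" where
  "closed_subspace Y V \<longleftrightarrow>
     subspace Y \<and> Y \<subseteq> vecs V \<and>
     (\<forall>s x. (\<forall>n::nat. s n \<in> Y) \<and> x \<in> vecs V \<and> (\<lambda>n. nrm V (s n - x)) \<longlonglongrightarrow> 0 \<longrightarrow> x \<in> Y)"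

text \<open>A functional on \<open>V\<close> is represented by a total function that vanishes outside \<open>V\<close>, so that
  equality of functionals is equality of functions.\<close>

definition dual_space :: "'a::real_vector nspace \<Rightarrow> ('a \<Rightarrow> real) nspace" where
  "dual_space V = NSpace
     {f. (\<forall>x\<in>vecs V. \<forall>y\<in>vecs V. f (x + y) = f x + f y) \<and>
         (\<forall>x\<in>vecs V. \<forall>c. f (c *\<^sub>R x) = c * f x) \<and>
         (\<exists>K. \<forall>x\<in>vecs V. \<bar>f x\<bar> \<le> K * nrm V x) \<and>
         (\<forall>x. x \<notin> vecs V \<longrightarrow> f x = 0)}
     (\<lambda>f. SUP x\<in>unit_ball V. \<bar>f x\<bar>)"

text \<open>Families are extended by \<open>0\<close> outside \<open>I\<close>.  Inserting \<open>0\<close> below the supremum matters only for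
  \<open>I = {}\<close>, where the sum is the zero space.\<close>

definition c0_sum :: "'i set \<Rightarrow> ('i \<Rightarrow> 'a::real_vector nspace) \<Rightarrow> ('i \<Rightarrow> 'a) nspace" where
  "c0_sum I X = NSpace
     {x. (\<forall>i\<in>I. x i \<in> vecs (X i)) \<and> (\<forall>i. i \<notin> I \<longrightarrow> x i = 0) \<and>
         (\<forall>e>0. finite {i \<in> I. e \<le> nrm (X i) (x i)})}
     (\<lambda>x. Sup (insert 0 ((\<lambda>i. nrm (X i) (x i)) ` I)))"

definition SSD_point :: "'a::real_vector nspace \<Rightarrow> 'a \<Rightarrow> bool" where
  "SSD_point V v \<longleftrightarrow>
     v \<in> vecs V \<and>
     (\<exists>D. uniform_limit (unit_ball V) (\<lambda>t h. (nrm V (v + t *\<^sub>R h) - nrm V v) / t) D (at_right 0))"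

definition set_dist :: "'a::real_vector nspace \<Rightarrow> 'a \<Rightarrow> 'a set \<Rightarrow> real" where
  "set_dist V x Y = (INF y\<in>Y. nrm V (x - y))"

definition metric_proj :: "'a::real_vector nspace \<Rightarrow> 'a set \<Rightarrow> 'a \<Rightarrow> 'a set" where
  "metric_proj V Y x = {y \<in> Y. set_dist V x Y = nrm V (x - y)}"

definition proximinal :: "'a::real_vector set \<Rightarrow> 'a nspace \<Rightarrow> bool" where
  "proximinal Y V \<longleftrightarrow>
     closed_subspace Y V \<and> (\<forall>x \<in> vecs V - Y. metric_proj V Y x \<noteq> {})"

definition strongly_proximinal :: "'a::real_vector set \<Rightarrow> 'a nspace \<Rightarrow> bool" where
  "strongly_proximinal Y V \<longleftrightarrow>
     proximinal Y V \<and>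
     (\<forall>x \<in> vecs V - Y. \<forall>y::nat \<Rightarrow> 'a.
        (\<forall>n. y n \<in> Y) \<and> (\<lambda>n. nrm V (x - y n)) \<longlonglongrightarrow> set_dist V x Y \<longrightarrow>
        (\<exists>r z. strict_mono r \<and> (\<forall>k. z k \<in> metric_proj V Y x) \<and>
           (\<lambda>k. nrm V (y (r k) - z k)) \<longlonglongrightarrow> 0))"

definition common_kernel :: "'a nspace \<Rightarrow> ('a \<Rightarrow> real) set \<Rightarrow> 'a set" where
  "common_kernel V F = {x \<in> vecs V. \<forall>f\<in>F. f x = 0}"

end

theory Submission
  imports Defs
begin

text \<open>
  The dual of the \<open>c\<^sub>0\<close>-sum is the \<open>\<ell>\<^sub>1\<close>-sum of the duals, so an SSD-point \<open>f\<close> of it has finite support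
  and its components \<open>f\<^sub>i\<close> are SSD-points.  Hence, for the common kernel \<open>Y\<close> of finitely many SSD-points,
  all functionals live on a finite set \<open>J\<close> of coordinates.

  For \<open>y\<^sub>n\<close> minimizing the distance \<open>d\<close> of \<open>x\<close> to \<open>Y\<close>, put \<open>u\<^sub>n = x - y\<^sub>n\<close> and pass to a subsequence
  along which all the numbers \<open>f\<^sub>i (u\<^sub>n i)\<close> converge, say to \<open>w\<^sub>i(f)\<close>.  It suffices to find, for each
  \<open>i \<in> J\<close>, vectors \<open>z\<^sub>n i\<close> close to \<open>u\<^sub>n i\<close> with \<open>f\<^sub>i (z\<^sub>n i) = w\<^sub>i(f)\<close> and norm at most \<open>d\<close>; the
  coordinates outside \<open>J\<close> are merely shrunk to norm at most \<open>d\<close>, and then \<open>x - z\<^sub>n\<close> is a best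
  approximation close to \<open>y\<^sub>n\<close>.  A small correction by fixed vectors moves \<open>u\<^sub>n i\<close> into the fibre of
  \<open>w\<^sub>i\<close>.  If the fibre meets the open \<open>d\<close>-ball, a convex combination with a point there restores the norm
  bound; otherwise the fibre has distance exactly \<open>d\<close> from \<open>0\<close> and strong proximinality in \<open>X\<^sub>i\<close> applies.
\<close>

section \<open>Normed spaces and their functionals\<close>

lemma scaleR_fun_apply: "(c *\<^sub>R f) x = c *\<^sub>R f x"
  by (simp add: scaleR_fun_def)

lemma normed_space_subspace: "normed_space V \<Longrightarrow> subspace (vecs V)"
  by (simp add: normed_space_def)

lemmas vecs_closed =
  subspace_0[OF normed_space_subspace] subspace_add[OF normed_space_subspace]
  subspace_diff[OF normed_space_subspace] subspace_neg[OF normed_space_subspace]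
  subspace_scale[OF normed_space_subspace]

lemma nrm_nonneg: "normed_space V \<Longrightarrow> x \<in> vecs V \<Longrightarrow> 0 \<le> nrm V x"
  by (simp add: normed_space_def)

lemma nrm_eq_0_iff: "normed_space V \<Longrightarrow> x \<in> vecs V \<Longrightarrow> nrm V x = 0 \<longleftrightarrow> x = 0"
  by (simp add: normed_space_def)

lemma nrm_zero: "normed_space V \<Longrightarrow> nrm V 0 = 0"
  by (simp add: nrm_eq_0_iff normed_space_subspace subspace_0)

lemma nrm_scaleR: "normed_space V \<Longrightarrow> x \<in> vecs V \<Longrightarrow> nrm V (c *\<^sub>R x) = \<bar>c\<bar> * nrm V x"
  by (simp add: normed_space_def)

lemma nrm_triangle:
  "normed_space V \<Longrightarrow> x \<in> vecs V \<Longrightarrow> y \<in> vecs V \<Longrightarrow> nrm V (x + y) \<le> nrm V x + nrm V y"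
  by (simp add: normed_space_def)

lemma nrm_minus: "normed_space V \<Longrightarrow> x \<in> vecs V \<Longrightarrow> nrm V (- x) = nrm V x"
  using nrm_scaleR[of V x "-1"] by simp

lemma nrm_minus_commute:
  assumes "normed_space V" "x \<in> vecs V" "y \<in> vecs V"
  shows "nrm V (x - y) = nrm V (y - x)"
  using nrm_minus[OF assms(1), of "x - y"] assms by (simp add: vecs_closed)

lemma nrm_triangle_diff:
  assumes "normed_space V" "x \<in> vecs V" "y \<in> vecs V"
  shows "nrm V (x - y) \<le> nrm V x + nrm V y"
  using nrm_triangle[OF assms(1,2), of "- y"] nrm_minus[OF assms(1,3)] assms
  by (simp add: vecs_closed)

lemma nrm_sum_le:
  assumes "normed_space V" "finite A" "\<And>a. a \<in> A \<Longrightarrow> e a \<in> vecs V"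
  shows "nrm V (\<Sum>a\<in>A. e a) \<le> (\<Sum>a\<in>A. nrm V (e a))"
  using assms(2,3)
proof (induction A)
  case empty
  then show ?case using nrm_zero[OF assms(1)] by simp
next
  case (insert a A)
  have "(\<Sum>a\<in>A. e a) \<in> vecs V"
    using insert by (intro subspace_sum normed_space_subspace assms(1)) auto
  then have "nrm V (e a + (\<Sum>a\<in>A. e a)) \<le> nrm V (e a) + nrm V (\<Sum>a\<in>A. e a)"
    using insert by (intro nrm_triangle assms(1)) auto
  then show ?case using insert by auto
qed

lemma zero_in_unit_ball: "normed_space V \<Longrightarrow> 0 \<in> unit_ball V"
  by (simp add: unit_ball_def nrm_zero normed_space_subspace subspace_0)

section \<open>Bounded functionals and the operator norm\<close>

lemma dual_spaceI:
  assumes "\<And>x y. x \<in> vecs V \<Longrightarrow> y \<in> vecs V \<Longrightarrow> f (x + y) = f x + f y"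
    and "\<And>x c. x \<in> vecs V \<Longrightarrow> f (c *\<^sub>R x) = c * f x"
    and "\<And>x. x \<in> vecs V \<Longrightarrow> \<bar>f x\<bar> \<le> K * nrm V x"
    and "\<And>x. x \<notin> vecs V \<Longrightarrow> f x = 0"
  shows "f \<in> vecs (dual_space V)"
proof -
  have "\<exists>K. \<forall>x\<in>vecs V. \<bar>f x\<bar> \<le> K * nrm V x" using assms(3) by blast
  then show ?thesis using assms(1,2,4) by (simp add: dual_space_def)
qed

lemma dual_space_add:
  "f \<in> vecs (dual_space V) \<Longrightarrow> x \<in> vecs V \<Longrightarrow> y \<in> vecs V \<Longrightarrow> f (x + y) = f x + f y"
  by (simp add: dual_space_def)

lemma dual_space_scaleR: "f \<in> vecs (dual_space V) \<Longrightarrow> x \<in> vecs V \<Longrightarrow> f (c *\<^sub>R x) = c * f x"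
  by (simp add: dual_space_def)

lemma dual_space_outside: "f \<in> vecs (dual_space V) \<Longrightarrow> x \<notin> vecs V \<Longrightarrow> f x = 0"
  by (simp add: dual_space_def)

lemma dual_space_zero: "normed_space V \<Longrightarrow> f \<in> vecs (dual_space V) \<Longrightarrow> f 0 = 0"
  using dual_space_scaleR[of f V 0 0] by (simp add: normed_space_subspace subspace_0)

lemma dual_space_diff:
  assumes "normed_space V" "f \<in> vecs (dual_space V)" "x \<in> vecs V" "y \<in> vecs V"
  shows "f (x - y) = f x - f y"
  using dual_space_add[OF assms(2), of "x - y" y] assms by (simp add: vecs_closed)

lemma dual_space_sum:
  assumes "normed_space V" "f \<in> vecs (dual_space V)" "finite A" "\<And>a. a \<in> A \<Longrightarrow> e a \<in> vecs V"
  shows "f (\<Sum>a\<in>A. c a *\<^sub>R e a) = (\<Sum>a\<in>A. c a * f (e a))"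
  using assms(3,4)
proof (induction A)
  case empty
  then show ?case using dual_space_zero[OF assms(1,2)] by simp
next
  case (insert a A)
  have "(\<Sum>a\<in>A. c a *\<^sub>R e a) \<in> vecs V"
    using insert subspace_scale[OF normed_space_subspace[OF assms(1)]]
    by (intro subspace_sum normed_space_subspace assms(1)) auto
  then show ?case
    using insert dual_space_add[OF assms(2), of "c a *\<^sub>R e a" "\<Sum>a\<in>A. c a *\<^sub>R e a"]
      dual_space_scaleR[OF assms(2)] subspace_scale[OF normed_space_subspace[OF assms(1)]]
    by simp
qed

lemma dual_space_bdd_above:
  assumes "normed_space V" "f \<in> vecs (dual_space V)"
  shows "bdd_above ((\<lambda>x. \<bar>f x\<bar>) ` unit_ball V)"
proof -
  obtain K where K: "\<And>x. x \<in> vecs V \<Longrightarrow> \<bar>f x\<bar> \<le> K * nrm V x"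
    using assms unfolding dual_space_def by force
  have "\<bar>f x\<bar> \<le> \<bar>K\<bar>" if "x \<in> unit_ball V" for x
  proof -
    have x: "x \<in> vecs V" "nrm V x \<le> 1" using that by (auto simp: unit_ball_def)
    have "K * nrm V x \<le> \<bar>K\<bar> * 1"
      using x nrm_nonneg[OF assms(1)] by (intro mult_mono) auto
    then show ?thesis using K[OF x(1)] by simp
  qed
  then show ?thesis by (auto intro!: bdd_aboveI)
qed

lemma dual_nrm_upper:
  "normed_space V \<Longrightarrow> f \<in> vecs (dual_space V) \<Longrightarrow> x \<in> unit_ball V \<Longrightarrow> \<bar>f x\<bar> \<le> nrm (dual_space V) f"
  using cSUP_upper[OF _ dual_space_bdd_above] by (simp add: dual_space_def)

lemma dual_nrm_least:
  assumes "normed_space V" "\<And>x. x \<in> unit_ball V \<Longrightarrow> \<bar>f x\<bar> \<le> K"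
  shows "nrm (dual_space V) f \<le> K"
proof -
  have "(SUP x\<in>unit_ball V. \<bar>f x\<bar>) \<le> K"
    using assms zero_in_unit_ball by (intro cSUP_least) auto
  then show ?thesis by (simp add: dual_space_def)
qed

lemma dual_nrm_nonneg:
  "normed_space V \<Longrightarrow> f \<in> vecs (dual_space V) \<Longrightarrow> 0 \<le> nrm (dual_space V) f"
  using dual_nrm_upper[OF _ _ zero_in_unit_ball] by fastforce

lemma dual_abs_le:
  assumes V: "normed_space V" and f: "f \<in> vecs (dual_space V)" and x: "x \<in> vecs V"
  shows "\<bar>f x\<bar> \<le> nrm (dual_space V) f * nrm V x"
proof (cases "nrm V x = 0")
  case True
  then show ?thesis using nrm_eq_0_iff[OF V x] dual_space_zero[OF V f] by simp
next
  case False
  then have pos: "nrm V x > 0" using nrm_nonneg[OF V x] by simp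
  have "(1 / nrm V x) *\<^sub>R x \<in> unit_ball V"
    using x pos by (simp add: unit_ball_def nrm_scaleR[OF V] subspace_scale normed_space_subspace[OF V])
  from dual_nrm_upper[OF V f this] show ?thesis
    using pos by (simp add: dual_space_scaleR[OF f x] abs_mult field_simps)
qed

lemma dual_space_subspace:
  assumes V: "normed_space V"
  shows "subspace (vecs (dual_space V))"
proof (rule subspaceI)
  show "0 \<in> vecs (dual_space V)"
    by (rule dual_spaceI[where K = 0]) auto
next
  fix f g assume f: "f \<in> vecs (dual_space V)" and g: "g \<in> vecs (dual_space V)"
  show "f + g \<in> vecs (dual_space V)"
  proof (rule dual_spaceI[where K = "nrm (dual_space V) f + nrm (dual_space V) g"])
    fix x assume "x \<in> vecs V"
    then show "\<bar>(f + g) x\<bar> \<le> (nrm (dual_space V) f + nrm (dual_space V) g) * nrm V x"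
      using dual_abs_le[OF V f, of x] dual_abs_le[OF V g, of x] by (simp add: algebra_simps)
  qed (use f g in \<open>auto simp: dual_space_add dual_space_scaleR dual_space_outside algebra_simps\<close>)
next
  fix c :: real and f assume f: "f \<in> vecs (dual_space V)"
  show "c *\<^sub>R f \<in> vecs (dual_space V)"
  proof (rule dual_spaceI[where K = "\<bar>c\<bar> * nrm (dual_space V) f"])
    fix x assume "x \<in> vecs V"
    then show "\<bar>(c *\<^sub>R f) x\<bar> \<le> \<bar>c\<bar> * nrm (dual_space V) f * nrm V x"
      using mult_left_mono[OF dual_abs_le[OF V f, of x], of "\<bar>c\<bar>"]
      by (simp add: scaleR_fun_apply abs_mult mult.assoc)
  qed (use f in \<open>auto simp: scaleR_fun_apply dual_space_add dual_space_scaleR dual_space_outside algebra_simps\<close>)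
qed

lemma dual_nrm_scaleR:
  assumes V: "normed_space V" and f: "f \<in> vecs (dual_space V)"
  shows "nrm (dual_space V) (c *\<^sub>R f) = \<bar>c\<bar> * nrm (dual_space V) f"
proof -
  have le: "nrm (dual_space V) (c *\<^sub>R g) \<le> \<bar>c\<bar> * nrm (dual_space V) g"
    if g: "g \<in> vecs (dual_space V)" for c g
    using dual_nrm_upper[OF V g]
    by (intro dual_nrm_least[OF V]) (simp add: scaleR_fun_apply abs_mult mult_left_mono)
  have cf: "c *\<^sub>R f \<in> vecs (dual_space V)"
    by (intro subspace_scale dual_space_subspace V f)
  show ?thesis
  proof (cases "c = 0")
    case True
    then show ?thesis using le[OF f, of c] dual_nrm_nonneg[OF V cf] by simp
  next
    case False
    then have "nrm (dual_space V) f \<le> (1 / \<bar>c\<bar>) * nrm (dual_space V) (c *\<^sub>R f)"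
      using le[OF cf, of "1 / c"] by simp
    then show ?thesis using le[OF f, of c] False by (simp add: field_simps)
  qed
qed

section \<open>Common kernels of bounded functionals\<close>

lemma common_kernel_closed:
  assumes V: "normed_space V" and F: "F \<subseteq> vecs (dual_space V)"
  shows "closed_subspace (common_kernel V F) V"
  unfolding closed_subspace_def
proof (intro conjI allI impI)
  show "subspace (common_kernel V F)"
    using F V dual_space_zero[OF V]
    by (auto simp: subspace_def common_kernel_def dual_space_add[of _ V] dual_space_scaleR[of _ V]
        subset_iff vecs_closed)
  show "common_kernel V F \<subseteq> vecs V" by (auto simp: common_kernel_def)
next
  fix s :: "nat \<Rightarrow> 'a" and x
  assume A: "(\<forall>n. s n \<in> common_kernel V F) \<and> x \<in> vecs V \<and> (\<lambda>n. nrm V (s n - x)) \<longlonglongrightarrow> 0"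
  have "f x = 0" if "f \<in> F" for f
  proof -
    have f: "f \<in> vecs (dual_space V)" using that F by auto
    have "\<bar>f x\<bar> \<le> nrm (dual_space V) f * nrm V (s n - x)" for n
    proof -
      have s: "s n \<in> vecs V" "f (s n) = 0" using A that by (auto simp: common_kernel_def)
      then have "f (s n - x) = - f x" using dual_space_diff[OF V f s(1)] A by simp
      then show ?thesis
        using dual_abs_le[OF V f, of "s n - x"] s A subspace_diff[OF normed_space_subspace[OF V]]
        by simp
    qed
    moreover have "(\<lambda>n. nrm (dual_space V) f * nrm V (s n - x)) \<longlonglongrightarrow> nrm (dual_space V) f * 0"
      using A by (intro tendsto_mult) auto
    ultimately have "\<bar>f x\<bar> \<le> nrm (dual_space V) f * 0"
      by (intro LIMSEQ_le_const) auto
    then show ?thesis by simp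
  qed
  then show "x \<in> common_kernel V F" using A by (simp add: common_kernel_def)
qed

lemma common_kernel_diff_eq:
  assumes "normed_space V" "F \<subseteq> vecs (dual_space V)" "x \<in> vecs V" "y \<in> vecs V"
  shows "x - y \<in> common_kernel V F \<longleftrightarrow> (\<forall>f\<in>F. f x = f y)"
proof -
  have "f (x - y) = 0 \<longleftrightarrow> f x = f y" if "f \<in> F" for f
    using dual_space_diff[OF assms(1) _ assms(3,4), of f] assms(2) that by auto
  then have "(\<forall>f\<in>F. f (x - y) = 0) \<longleftrightarrow> (\<forall>f\<in>F. f x = f y)" by (intro ball_cong refl)
  then show ?thesis using assms by (simp add: common_kernel_def vecs_closed)
qed

section \<open>Strong proximinality of common kernels\<close>

lemma set_dist_lower:
  assumes "normed_space V" "Y \<subseteq> vecs V" "x \<in> vecs V" "y \<in> Y"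
  shows "set_dist V x Y \<le> nrm V (x - y)"
proof -
  have "bdd_below ((\<lambda>y. nrm V (x - y)) ` Y)"
    using assms nrm_nonneg[OF assms(1)] subspace_diff[OF normed_space_subspace[OF assms(1)]]
    by (intro bdd_belowI[of _ 0]) auto
  then show ?thesis unfolding set_dist_def using assms by (intro cINF_lower) auto
qed

lemma minimizing_sequenceI:
  assumes "normed_space V" "Y \<subseteq> vecs V" "x \<in> vecs V"
    and "\<And>n. y n \<in> Y" "\<And>n. nrm V (x - y n) < set_dist V x Y + 1 / Suc n"
  shows "(\<lambda>n. nrm V (x - y n)) \<longlonglongrightarrow> set_dist V x Y"
proof (rule tendsto_sandwich)
  show "(\<lambda>n. set_dist V x Y) \<longlonglongrightarrow> set_dist V x Y" by simp
  show "(\<lambda>n. set_dist V x Y + 1 / Suc n) \<longlonglongrightarrow> set_dist V x Y"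
    using tendsto_add[OF tendsto_const LIMSEQ_inverse_real_of_nat] by (simp add: inverse_eq_divide)
qed (use set_dist_lower[OF assms(1-4)] less_imp_le[OF assms(5)] in \<open>auto simp del: of_nat_Suc\<close>)

text \<open>A diagonal choice turns approximation within every \<open>e\<close> along one
  subsequence into a single sequence of best approximations. Proximinality needs no separate
  hypothesis: minimizing sequences always exist, and \<open>near\<close> applied to one of them
  already produces a point of the metric projection.\<close>

lemma strongly_proximinalI:
  assumes V: "normed_space V" and Y: "closed_subspace Y V"
    and near: "\<And>x y. x \<in> vecs V - Y \<Longrightarrow> (\<And>n. y n \<in> Y) \<Longrightarrow>
      (\<lambda>n. nrm V (x - y n)) \<longlonglongrightarrow> set_dist V x Y \<Longrightarrow>
      \<exists>s. strict_mono s \<and>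
        (\<forall>e>0. \<forall>\<^sub>F n in sequentially. \<exists>z\<in>metric_proj V Y x. nrm V (y (s n) - z) < e)"
  shows "strongly_proximinal Y V"
proof -
  have sub: "Y \<subseteq> vecs V" "0 \<in> Y" using Y by (auto simp: closed_subspace_def subspace_0)
  have main: "\<exists>r z. strict_mono r \<and> (\<forall>k. z k \<in> metric_proj V Y x) \<and>
      (\<lambda>k. nrm V (y (r k) - z k)) \<longlonglongrightarrow> 0"
    if x: "x \<in> vecs V - Y" and y: "\<And>n. y n \<in> Y"
      and lim: "(\<lambda>n. nrm V (x - y n)) \<longlonglongrightarrow> set_dist V x Y" for x and y :: "nat \<Rightarrow> 'a"
  proof -
    obtain s where s: "strict_mono s" and ev: "\<And>e. e > 0 \<Longrightarrow>
        \<forall>\<^sub>F n in sequentially. \<exists>z\<in>metric_proj V Y x. nrm V (y (s n) - z) < e"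
      using near[OF x y lim] by blast
    have "\<exists>N. \<forall>n\<ge>N. \<exists>z\<in>metric_proj V Y x. nrm V (y (s n) - z) < 1 / Suc k" for k
      using ev[of "1 / Suc k"] by (simp add: eventually_sequentially)
    then obtain N where N: "\<And>k n. n \<ge> N k \<Longrightarrow> \<exists>z\<in>metric_proj V Y x. nrm V (y (s n) - z) < 1 / Suc k"
      by metis
    \<comment> \<open>The sum puts \<open>r k\<close> above the threshold \<open>N k\<close>; the
      summand \<open>k\<close> makes \<open>r\<close> strictly increasing even where
      \<open>N\<close> vanishes.\<close>
    define r where "r k = k + (\<Sum>j\<le>k. N j)" for k
    have r: "strict_mono r" by (simp add: r_def strict_mono_Suc_iff)
    have "N k \<le> r k" for k by (cases k) (auto simp: r_def)
    then have "\<exists>z\<in>metric_proj V Y x. nrm V (y (s (r k)) - z) < 1 / Suc k" for k by (rule N)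
    then obtain z where z: "\<And>k. z k \<in> metric_proj V Y x"
      and z_lt: "\<And>k. nrm V (y (s (r k)) - z k) < 1 / Suc k" by metis
    have "(\<lambda>k. nrm V (y (s (r k)) - z k)) \<longlonglongrightarrow> 0"
    proof (rule tendsto_sandwich[where f = "\<lambda>_. 0"])
      show "(\<lambda>k. 1 / Suc k) \<longlonglongrightarrow> 0"
        using LIMSEQ_inverse_real_of_nat by (simp add: inverse_eq_divide)
      have "y (s (r k)) - z k \<in> vecs V" for k
        using y z[of k] sub by (intro vecs_closed V) (auto simp: metric_proj_def)
      then show "\<forall>\<^sub>F k in sequentially. 0 \<le> nrm V (y (s (r k)) - z k)"
        by (simp add: nrm_nonneg[OF V])
    qed (use less_imp_le[OF z_lt] in \<open>auto simp del: of_nat_Suc\<close>)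
    then show ?thesis using strict_mono_o[OF s r] z by (intro exI[of _ "s \<circ> r"] exI[of _ z]) simp
  qed
  have "metric_proj V Y x \<noteq> {}" if x: "x \<in> vecs V - Y" for x
  proof -
    have "\<exists>y\<in>Y. nrm V (x - y) < set_dist V x Y + 1 / Suc n" for n
      using sub(2) cInf_lessD[of "(\<lambda>y. nrm V (x - y)) ` Y" "set_dist V x Y + 1 / Suc n"]
      by (auto simp: set_dist_def)
    then obtain y where y: "\<And>n. y n \<in> Y" "\<And>n. nrm V (x - y n) < set_dist V x Y + 1 / Suc n"
      by metis
    then show ?thesis using main[of x y, OF x y(1)] minimizing_sequenceI[OF V sub(1) _ y] x by blast
  qed
  then show ?thesis using Y main unfolding strongly_proximinal_def proximinal_def by blast
qed

text \<open>If every \<open>d\<close> of the form \<open>1 / Suc n\<close> failed, the witnesses of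
  failure would be a minimizing sequence in \<open>Y\<close> all of whose terms stay at distance at
  least \<open>e\<close> from the metric projection. No subsequence could then satisfy the
  sequential definition.\<close>

lemma strongly_proximinalD:
  assumes V: "normed_space V" and Y: "strongly_proximinal Y V"
    and x: "x \<in> vecs V - Y" and "e > 0"
  obtains d where "d > 0"
    "\<And>y. y \<in> Y \<Longrightarrow> nrm V (x - y) < set_dist V x Y + d \<Longrightarrow> \<exists>z\<in>metric_proj V Y x. nrm V (y - z) < e"
proof (rule ccontr)
  assume neg: "\<not> thesis"
  have sub: "Y \<subseteq> vecs V"
    using Y by (auto simp: strongly_proximinal_def proximinal_def closed_subspace_def)
  have "\<exists>y. y \<in> Y \<and> nrm V (x - y) < set_dist V x Y + 1 / Suc n \<and>
      \<not> (\<exists>z\<in>metric_proj V Y x. nrm V (y - z) < e)" for n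
    using that[of "1 / Suc n"] neg by auto
  then obtain y where y: "\<And>n. y n \<in> Y" "\<And>n. nrm V (x - y n) < set_dist V x Y + 1 / Suc n"
    "\<And>n z. z \<in> metric_proj V Y x \<Longrightarrow> \<not> nrm V (y n - z) < e"
    by metis
  have "(\<lambda>n. nrm V (x - y n)) \<longlonglongrightarrow> set_dist V x Y"
    using minimizing_sequenceI[OF V sub _ y(1,2)] x by simp
  then obtain r z where rz: "\<And>k. z k \<in> metric_proj V Y x" "(\<lambda>k. nrm V (y (r k) - z k)) \<longlonglongrightarrow> 0"
    using Y x y(1) unfolding strongly_proximinal_def by blast
  from order_tendstoD(2)[OF rz(2) \<open>e > 0\<close>] obtain k where "nrm V (y (r k) - z k) < e"
    by (auto simp: eventually_sequentially)
  then show False using y(3) rz(1) by blast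
qed

section \<open>Fibres of finitely many functionals\<close>

text \<open>These fixed vectors allow the values of all functionals in \<open>G\<close> to be
  corrected at once, with an error in norm controlled by the correction. Linear independence of
  \<open>G\<close> is not assumed: in the induction a new \<open>h\<close> either vanishes on the
  common kernel of \<open>G\<close>, hence is a combination of its members and receives the vector
  0, or it receives some \<open>p\<close> in that kernel with \<open>h p = 1\<close>, and the older
  vectors are shifted along \<open>p\<close> until \<open>h\<close> vanishes on them.\<close>

lemma dual_vectors:
  assumes V: "normed_space V" and "finite G" "G \<subseteq> vecs (dual_space V)"
  obtains e where "\<And>g. e g \<in> vecs V"
    "\<And>f x. f \<in> G \<Longrightarrow> x \<in> vecs V \<Longrightarrow> f x = (\<Sum>g\<in>G. g x * f (e g))"
proof -
  have "\<exists>e. (\<forall>g. e g \<in> vecs V) \<and> (\<forall>f\<in>G. \<forall>x\<in>vecs V. f x = (\<Sum>g\<in>G. g x * f (e g)))"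
    using assms(2,3)
  proof (induction G)
    case empty
    then show ?case using subspace_0[OF normed_space_subspace[OF V]] by auto
  next
    case (insert h G)
    then have "\<exists>e. (\<forall>g. e g \<in> vecs V) \<and> (\<forall>f\<in>G. \<forall>x\<in>vecs V. f x = (\<Sum>g\<in>G. g x * f (e g)))" by simp
    then obtain e where e: "\<And>g. e g \<in> vecs V"
      and eq: "\<And>f x. f \<in> G \<Longrightarrow> x \<in> vecs V \<Longrightarrow> f x = (\<Sum>g\<in>G. g x * f (e g))" by blast
    have h: "h \<in> vecs (dual_space V)" and G: "\<And>g. g \<in> G \<Longrightarrow> g \<in> vecs (dual_space V)"
      using insert by auto
    note sub = normed_space_subspace[OF V]
    have P: "(\<Sum>g\<in>G. g x *\<^sub>R e g) \<in> vecs V" for x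
      by (intro subspace_sum subspace_scale sub e)
    have Pf: "f (\<Sum>g\<in>G. g x *\<^sub>R e g) = (\<Sum>g\<in>G. g x * f (e g))"
      if "f \<in> vecs (dual_space V)" for f x
      by (rule dual_space_sum[OF V that insert(1)]) (rule e)
    show ?case
    proof (cases "\<forall>p\<in>common_kernel V G. h p = 0")
      case True
      define e' where "e' = e(h := 0)"
      have e': "e' h = 0" "\<And>g. g \<in> G \<Longrightarrow> e' g = e g" using insert(2) by (auto simp: e'_def)
      have "h x = (\<Sum>g\<in>G. g x * h (e g))" if x: "x \<in> vecs V" for x
      proof -
        have "x - (\<Sum>g\<in>G. g x *\<^sub>R e g) \<in> common_kernel V G"
          using common_kernel_diff_eq[OF V _ x P, of G x] G Pf eq x by (simp add: subset_iff)
        then have "h (x - (\<Sum>g\<in>G. g x *\<^sub>R e g)) = 0" using True by blast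
        then show ?thesis using dual_space_diff[OF V h x P] Pf[OF h] by simp
      qed
      then have "f x = (\<Sum>g\<in>insert h G. g x * f (e' g))" if "f \<in> insert h G" "x \<in> vecs V" for f x
        using that insert(1,2) e' eq dual_space_zero[OF V, of f] h G by auto
      moreover have "e' g \<in> vecs V" for g using e subspace_0[OF sub] by (simp add: e'_def)
      ultimately show ?thesis by blast
    next
      case False
      then obtain p0 where p0: "p0 \<in> common_kernel V G" "h p0 \<noteq> 0" by auto
      define p where "p = (1 / h p0) *\<^sub>R p0"
      have p0V: "p0 \<in> vecs V" using p0 by (simp add: common_kernel_def)
      have p: "p \<in> vecs V" "h p = 1"
        using p0 dual_space_scaleR[OF h p0V] subspace_scale[OF sub p0V] by (simp_all add: p_def)
      have gp: "g p = 0" if "g \<in> G" for g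
        using p0 that dual_space_scaleR[OF G[OF that] p0V, of "1 / h p0"]
        by (simp add: p_def common_kernel_def)
      define e' where "e' g = (if g = h then p else e g - h (e g) *\<^sub>R p)" for g
      have f_e': "f (e' g) = f (e g) - h (e g) * f p"
        if "f \<in> insert h G" "g \<in> G" for f g
      proof -
        have "f \<in> vecs (dual_space V)" "g \<noteq> h" using that h G insert(2) by auto
        then show ?thesis
          using dual_space_diff[OF V _ e subspace_scale[OF sub p(1)]] dual_space_scaleR[OF _ p(1)]
          by (auto simp: e'_def)
      qed
      have "f x = (\<Sum>g\<in>insert h G. g x * f (e' g))" if "f \<in> insert h G" "x \<in> vecs V" for f x
      proof (cases "f = h")
        case True
        have "h (e' g) = 0" if "g \<in> G" for g using f_e'[of h g] p(2) that by simp
        then show ?thesis using True p(2) insert(1,2) by (simp add: e'_def[of h])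
      next
        case False
        then have "f \<in> G" using that by simp
        have "f (e' g) = f (e g)" if "g \<in> G" for g
          using f_e'[of f g] gp[OF \<open>f \<in> G\<close>] that \<open>f \<in> G\<close> by simp
        then have "(\<Sum>g\<in>G. g x * f (e' g)) = f x" using eq[OF \<open>f \<in> G\<close>] that(2) by simp
        then show ?thesis using gp[OF \<open>f \<in> G\<close>] insert(1,2) by (simp add: e'_def[of h])
      qed
      moreover have "e' g \<in> vecs V" for g
        using e p(1) subspace_diff[OF sub] subspace_scale[OF sub] by (simp add: e'_def)
      ultimately show ?thesis by blast
    qed
  qed
  then show thesis using that by blast
qed

text \<open>This is the step inside one summand. In the application \<open>d\<close> is the distance
  in the whole sum, so the fibre of \<open>w\<close> in a single summand may well contain points of
  norm below \<open>d\<close>. Strong proximinality is decisive only when it contains none;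
  otherwise there is room to pull the vectors towards such a point.\<close>

lemma eventually_near_metric_fibre:
  assumes V: "normed_space V" and G: "finite G" "G \<subseteq> vecs (dual_space V)"
    and sp: "strongly_proximinal (common_kernel V G) V"
    and d: "d > 0" and u: "\<And>n. u n \<in> vecs V"
    and u_le: "\<And>e. e > 0 \<Longrightarrow> \<forall>\<^sub>F n in sequentially. nrm V (u n) < d + e"
    and lim: "\<And>f. f \<in> G \<Longrightarrow> (\<lambda>n. f (u n)) \<longlonglongrightarrow> w f"
    and e: "e > 0"
  shows "\<forall>\<^sub>F n in sequentially.
    \<exists>z\<in>vecs V. (\<forall>f\<in>G. f z = w f) \<and> nrm V z \<le> d \<and> nrm V (u n - z) < e"
proof -
  let ?Y = "common_kernel V G"
  have Y: "?Y \<subseteq> vecs V" by (auto simp: common_kernel_def)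
  have Gd: "f \<in> vecs (dual_space V)" if "f \<in> G" for f using G that by auto
  obtain b where b: "\<And>g. b g \<in> vecs V"
    and b_eq: "\<And>f x. f \<in> G \<Longrightarrow> x \<in> vecs V \<Longrightarrow> f x = (\<Sum>g\<in>G. g x * f (b g))"
    using dual_vectors[OF V G] by blast
  \<comment> \<open>The values \<open>w\<close> are only given as limits. The identity
    \<open>b_eq\<close> for \<open>u n\<close> passes to the limit and shows that \<open>p\<close>
    realizes them, so the fibre of \<open>w\<close> is nonempty. The vectors \<open>v n\<close> are
    the corrections that move \<open>u n\<close> into this fibre, and they tend to 0 because their
    coefficients do.\<close>
  define p where "p = (\<Sum>g\<in>G. w g *\<^sub>R b g)"
  define v where "v n = (\<Sum>g\<in>G. (w g - g (u n)) *\<^sub>R b g)" for n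
  define u' where "u' n = u n + v n" for n
  have p: "p \<in> vecs V" and v: "v n \<in> vecs V" for n
    unfolding p_def v_def by (intro subspace_sum normed_space_subspace V vecs_closed b)+
  then have u': "u' n \<in> vecs V" for n using u by (simp add: u'_def vecs_closed V)
  have fp: "f p = w f" if f: "f \<in> G" for f
  proof (rule LIMSEQ_unique)
    have "(\<lambda>n. \<Sum>g\<in>G. g (u n) * f (b g)) \<longlonglongrightarrow> (\<Sum>g\<in>G. w g * f (b g))"
      by (intro tendsto_sum tendsto_mult lim tendsto_const)
    then show "(\<lambda>n. f (u n)) \<longlonglongrightarrow> f p"
      using b_eq[OF f u] dual_space_sum[OF V Gd[OF f] G(1), of b w] b by (simp add: p_def)
    show "(\<lambda>n. f (u n)) \<longlonglongrightarrow> w f" by (rule lim[OF f])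
  qed
  have fu': "f (u' n) = w f" if f: "f \<in> G" for f n
  proof -
    have "f (v n) = (\<Sum>g\<in>G. w g * f (b g)) - (\<Sum>g\<in>G. g (u n) * f (b g))"
      using dual_space_sum[OF V Gd[OF f] G(1), of b "\<lambda>g. w g - g (u n)"] b
      by (simp add: v_def sum_subtractf left_diff_distrib)
    also have "\<dots> = w f - f (u n)"
      using b_eq[OF f u] fp[OF f] dual_space_sum[OF V Gd[OF f] G(1), of b w] b by (simp add: p_def)
    finally show ?thesis by (simp add: u'_def dual_space_add[OF Gd[OF f] u v])
  qed
  have v_lim: "(\<lambda>n. nrm V (v n)) \<longlonglongrightarrow> 0"
  proof (rule tendsto_sandwich[where f = "\<lambda>_. 0"])
    have "(\<lambda>n. \<Sum>g\<in>G. \<bar>w g - g (u n)\<bar> * nrm V (b g)) \<longlonglongrightarrow> (\<Sum>g\<in>G. \<bar>w g - w g\<bar> * nrm V (b g))"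
      by (intro tendsto_intros lim)
    then show "(\<lambda>n. \<Sum>g\<in>G. \<bar>w g - g (u n)\<bar> * nrm V (b g)) \<longlonglongrightarrow> 0" by simp
    show "\<forall>\<^sub>F n in sequentially. nrm V (v n) \<le> (\<Sum>g\<in>G. \<bar>w g - g (u n)\<bar> * nrm V (b g))"
    proof (intro always_eventually allI)
      fix n
      have "nrm V (v n) \<le> (\<Sum>g\<in>G. nrm V ((w g - g (u n)) *\<^sub>R b g))"
        unfolding v_def by (intro nrm_sum_le V G vecs_closed b)
      then show "nrm V (v n) \<le> (\<Sum>g\<in>G. \<bar>w g - g (u n)\<bar> * nrm V (b g))"
        by (simp add: nrm_scaleR[OF V b])
    qed
  qed (use nrm_nonneg[OF V v] in auto)
  have u'_le: "\<forall>\<^sub>F n in sequentially. nrm V (u' n) < d + a \<and> nrm V (v n) < e / 2" if "a > 0" for a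
    using u_le[OF half_gt_zero[OF that]] order_tendstoD(2)[OF v_lim half_gt_zero[OF that]]
      order_tendstoD(2)[OF v_lim half_gt_zero[OF e]]
  proof eventually_elim
    case (elim n)
    then show ?case using nrm_triangle[OF V u v, of n n] by (simp add: u'_def)
  qed
  have near: "nrm V (u n - z) < e"
    if "z \<in> vecs V" "nrm V (v n) < e / 2" "nrm V (u' n - z) < e / 2" for n z
  proof -
    have "nrm V ((u' n - z) - v n) \<le> nrm V (u' n - z) + nrm V (v n)"
      using that u' v by (intro nrm_triangle_diff vecs_closed V) auto
    then show ?thesis using that by (simp add: u'_def algebra_simps)
  qed
  \<comment> \<open>Both points lie in the fibre of \<open>w\<close>. Since
    \<open>u' n = p - (p - u' n)\<close>, the norm of \<open>u' n\<close> measures how well this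
    kernel element approximates \<open>p\<close>.\<close>
  have pu': "p - u' n \<in> ?Y" for n
    unfolding common_kernel_diff_eq[OF V G(2) p u'] by (metis fp fu')
  \<comment> \<open>By proximinality the fibre has a point \<open>p - y\<close> of least norm, and
    the \<open>u' n\<close> show that this norm is at most \<open>d\<close>. If \<open>p\<close>
    itself lies in the kernel, then \<open>w\<close> is 0 on \<open>G\<close> and the point 0 serves
    as \<open>q\<close>; so in the second case \<open>p\<close> lies outside the kernel, as strong
    proximinality requires.\<close>
  consider (small) q where "q \<in> vecs V" "\<And>f. f \<in> G \<Longrightarrow> f q = w f" "nrm V q < d"
    | (sphere) "p \<notin> ?Y" "set_dist V p ?Y = d"
  proof (cases "p \<in> ?Y")
    case True
    then have "w f = 0" if "f \<in> G" for f using fp that by (auto simp: common_kernel_def)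
    then show ?thesis
      using small[of 0] d dual_space_zero[OF V Gd] by (simp add: nrm_zero[OF V] vecs_closed V)
  next
    case False
    then obtain y where "y \<in> metric_proj V ?Y p"
      using sp p unfolding strongly_proximinal_def proximinal_def by blast
    then have y: "y \<in> ?Y" "nrm V (p - y) = set_dist V p ?Y" by (auto simp: metric_proj_def)
    have "f (p - y) = w f" if "f \<in> G" for f
      using dual_space_diff[OF V Gd p, of f y] y(1) that fp by (auto simp: common_kernel_def)
    moreover have "p - y \<in> vecs V" using p y(1) Y by (auto intro: vecs_closed V)
    moreover have "set_dist V p ?Y \<le> d"
    proof (rule field_le_epsilon)
      fix a :: real assume "a > 0"
      from u'_le[OF this] obtain n where "nrm V (u' n) < d + a"
        by (auto simp: eventually_sequentially)
      then show "set_dist V p ?Y \<le> d + a"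
        using set_dist_lower[OF V Y p pu'[of n]] by simp
    qed
    ultimately show ?thesis using small[of "p - y"] sphere False y(2) by fastforce
  qed
  then show ?thesis
  proof cases
    case small
    \<comment> \<open>The norm of \<open>u' n\<close> may exceed \<open>d\<close> by up to
      \<open>a\<close>. The weight \<open>l\<close> solves
      \<open>(1 - l) * (d + a) + l * nrm V q = d\<close>, which brings the convex combination back
      to norm at most \<open>d\<close>. The second bound on \<open>a\<close> gives
      \<open>l \<le> e / (8 * d)\<close>, and \<open>a \<le> d\<close> bounds the norm of
      \<open>u' n - q\<close> by \<open>3 * d\<close>; so the point moves by at most
      \<open>3 / 8 * e\<close>.\<close>
    define a where "a = min d (e * (d - nrm V q) / (8 * d))"
    have a: "a > 0" "a \<le> d" "a \<le> e * (d - nrm V q) / (8 * d)"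
      using d e small(3) by (auto simp: a_def)
    have q0: "0 \<le> nrm V q" by (rule nrm_nonneg[OF V small(1)])
    define l where "l = a / (a + d - nrm V q)"
    have l: "0 < l" "l < 1" "l * (a + d - nrm V q) = a" "l * (d - nrm V q) \<le> a"
      using a small(3) by (auto simp: l_def field_simps)
    from u'_le[OF a(1)] show ?thesis
    proof eventually_elim
      case (elim n)
      define z where "z = (1 - l) *\<^sub>R u' n + l *\<^sub>R q"
      have z: "z \<in> vecs V" using u' small(1) by (simp add: z_def vecs_closed V)
      have "f z = w f" if "f \<in> G" for f
      proof -
        have "f z = (1 - l) * f (u' n) + l * f q"
          by (simp add: z_def dual_space_add[OF Gd[OF that]] dual_space_scaleR[OF Gd[OF that]]
              vecs_closed V u' small(1))
        then show ?thesis using small(2)[OF that] fu'[OF that] by (simp add: algebra_simps)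
      qed
      moreover have "nrm V z \<le> d"
      proof -
        have "nrm V z \<le> (1 - l) * nrm V (u' n) + l * nrm V q"
          using nrm_triangle[OF V, of "(1 - l) *\<^sub>R u' n" "l *\<^sub>R q"] l
          by (simp add: z_def vecs_closed V u' small(1) nrm_scaleR)
        also have "\<dots> \<le> (1 - l) * (d + a) + l * nrm V q"
          using elim l by (intro add_mono mult_left_mono) auto
        also have "\<dots> = d" using l(3) by (simp add: algebra_simps)
        finally show ?thesis .
      qed
      moreover have "nrm V (u' n - z) < e / 2"
      proof -
        have "u' n - z = l *\<^sub>R (u' n - q)" by (simp add: z_def algebra_simps)
        then have "nrm V (u' n - z) = l * nrm V (u' n - q)"
          using l by (simp add: nrm_scaleR[OF V] vecs_closed V u' small(1))
        also have "\<dots> \<le> l * (nrm V (u' n) + nrm V q)"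
          using l by (intro mult_left_mono nrm_triangle_diff V u' small(1)) auto
        also have "\<dots> \<le> l * (3 * d)"
          using l elim a small(3) by (intro mult_left_mono) auto
        also have "\<dots> < e / 2"
        proof -
          have "l * (d - nrm V q) \<le> e * (d - nrm V q) / (8 * d)" using l(4) a(3) by simp
          then have "l \<le> e / (8 * d)"
            using mult_right_le_imp_le[of l "d - nrm V q" "e / (8 * d)"] small(3) by simp
          then have "l * (3 * d) \<le> e / (8 * d) * (3 * d)" using d by (intro mult_right_mono) auto
          also have "\<dots> = 3 / 8 * e" using d by simp
          also have "\<dots> < e / 2" using e by simp
          finally show ?thesis .
        qed
        finally show ?thesis .
      qed
      ultimately show ?case using near[OF z, of n] elim z by blast
    qed
  next
    case sphere
    \<comment> \<open>The bound is applied to the kernel element \<open>p - u' n\<close>. If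
      \<open>y\<close> is a best approximation of \<open>p\<close> near it, then
      \<open>p - y\<close> is a point of the fibre near \<open>u' n\<close> with norm exactly
      \<open>d\<close>.\<close>
    obtain a where a: "a > 0" "\<And>y. y \<in> ?Y \<Longrightarrow> nrm V (p - y) < d + a \<Longrightarrow>
        \<exists>z\<in>metric_proj V ?Y p. nrm V (y - z) < e / 2"
      using strongly_proximinalD[OF V sp, of p "e / 2"] p sphere e by auto
    from u'_le[OF a(1)] show ?thesis
    proof eventually_elim
      case (elim n)
      with a(2)[OF pu'[of n]] obtain y
        where "y \<in> metric_proj V ?Y p" "nrm V (p - u' n - y) < e / 2" by auto
      then have y: "y \<in> ?Y" "nrm V (p - y) = d" "nrm V (p - u' n - y) < e / 2"
        using sphere by (auto simp: metric_proj_def)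
      have z: "p - y \<in> vecs V" using p y(1) Y by (auto intro: vecs_closed V)
      have "f (p - y) = w f" if "f \<in> G" for f
        using dual_space_diff[OF V Gd p, of f y] y(1) that fp by (auto simp: common_kernel_def)
      moreover have "nrm V (u' n - (p - y)) < e / 2"
        using nrm_minus_commute[OF V u' z, of n] y(3) by (simp add: algebra_simps)
      ultimately show ?case using near[OF z, of n] elim z y(2) by fastforce
    qed
  qed
qed

text \<open>Bolzano-Weierstrass is applied once per member; each further extraction preserves the
  convergence already obtained.\<close>

lemma finite_family_convergent_subseq:
  fixes w :: "'b \<Rightarrow> nat \<Rightarrow> real"
  assumes "finite A" "\<And>a. a \<in> A \<Longrightarrow> bounded (range (w a))"
  obtains r :: "nat \<Rightarrow> nat" where "strict_mono r" "\<And>a. a \<in> A \<Longrightarrow> convergent (\<lambda>n. w a (r n))"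
proof -
  have "\<exists>r. strict_mono r \<and> (\<forall>a\<in>A. convergent (\<lambda>n. w a (r n)))"
    using assms
  proof (induction A)
    case empty
    show ?case using strict_mono_id by auto
  next
    case (insert a A)
    then obtain r where r: "strict_mono r" "\<And>b. b \<in> A \<Longrightarrow> convergent (\<lambda>n. w b (r n))" by auto
    have "bounded (range (\<lambda>n. w a (r n)))"
      by (rule bounded_subset[of "range (w a)"]) (use insert in auto)
    then obtain l q where q: "strict_mono q" "((\<lambda>n. w a (r n)) \<circ> q) \<longlonglongrightarrow> l"
      using bounded_imp_convergent_subsequence by blast
    have "convergent (\<lambda>n. w b ((r \<circ> q) n))" if b: "b \<in> insert a A" for b
    proof (cases "b = a")
      case True
      then show ?thesis using q(2) by (auto simp: convergent_def o_def)
    next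
      case False
      then show ?thesis using convergent_subseq_convergent[OF r(2) q(1), of b] b by (simp add: o_def)
    qed
    then show ?case using strict_mono_o[OF r(1) q(1)] by blast
  qed
  then show thesis using that by blast
qed

section \<open>The \<open>c\<^sub>0\<close>-sum and its functionals\<close>

lemma c0_sum_mem_iff:
  "x \<in> vecs (c0_sum I X) \<longleftrightarrow> (\<forall>i\<in>I. x i \<in> vecs (X i)) \<and> (\<forall>i. i \<notin> I \<longrightarrow> x i = 0) \<and>
    (\<forall>e>0. finite {i \<in> I. e \<le> nrm (X i) (x i)})"
  by (simp add: c0_sum_def)

lemma c0_sum_dominated:
  assumes "x \<in> vecs (c0_sum I X)" "finite S"
    and "\<And>i. i \<in> I \<Longrightarrow> y i \<in> vecs (X i)" "\<And>i. i \<notin> I \<Longrightarrow> y i = 0"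
    and "\<And>i. i \<in> I \<Longrightarrow> i \<notin> S \<Longrightarrow> nrm (X i) (y i) \<le> nrm (X i) (x i)"
  shows "y \<in> vecs (c0_sum I X)"
proof -
  have "finite {i \<in> I. e \<le> nrm (X i) (y i)}" if "e > 0" for e
  proof (rule finite_subset)
    show "{i \<in> I. e \<le> nrm (X i) (y i)} \<subseteq> S \<union> {i \<in> I. e \<le> nrm (X i) (x i)}"
      using assms(5) by fastforce
    show "finite (S \<union> {i \<in> I. e \<le> nrm (X i) (x i)})"
      using assms(1,2) that by (simp add: c0_sum_mem_iff)
  qed
  then show ?thesis using assms(3,4) by (simp add: c0_sum_mem_iff)
qed

text \<open>Only finitely many components have norm at least 1, and the remaining ones are bounded
  by 1.\<close>

lemma c0_sum_bdd_above:
  assumes "x \<in> vecs (c0_sum I X)"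
  shows "bdd_above (insert 0 ((\<lambda>i. nrm (X i) (x i)) ` I))"
proof -
  let ?S = "{i \<in> I. 1 \<le> nrm (X i) (x i)}"
  have "finite ?S" using assms by (simp add: c0_sum_mem_iff)
  then have "bdd_above ((\<lambda>i. nrm (X i) (x i)) ` ?S)" by simp
  moreover have "bdd_above ((\<lambda>i. nrm (X i) (x i)) ` (I - ?S))"
    by (rule bdd_aboveI[of _ 1]) auto
  ultimately have "bdd_above ((\<lambda>i. nrm (X i) (x i)) ` ?S \<union> (\<lambda>i. nrm (X i) (x i)) ` (I - ?S))"
    by simp
  then show ?thesis by (simp add: image_Un[symmetric] Un_absorb1)
qed

lemma c0_sum_nrm_le_iff:
  assumes "x \<in> vecs (c0_sum I X)"
  shows "nrm (c0_sum I X) x \<le> c \<longleftrightarrow> 0 \<le> c \<and> (\<forall>i\<in>I. nrm (X i) (x i) \<le> c)"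
proof -
  have "nrm (c0_sum I X) x \<le> c \<longleftrightarrow> (\<forall>a\<in>insert 0 ((\<lambda>i. nrm (X i) (x i)) ` I). a \<le> c)"
    unfolding c0_sum_def nspace.sel by (rule cSup_le_iff[OF _ c0_sum_bdd_above[OF assms]]) simp
  then show ?thesis by simp
qed

lemma c0_sum_nrm_component:
  "x \<in> vecs (c0_sum I X) \<Longrightarrow> i \<in> I \<Longrightarrow> nrm (X i) (x i) \<le> nrm (c0_sum I X) x"
  using c0_sum_nrm_le_iff[of x I X "nrm (c0_sum I X) x"] by simp

lemma c0_sum_nrm_nonneg: "x \<in> vecs (c0_sum I X) \<Longrightarrow> 0 \<le> nrm (c0_sum I X) x"
  using c0_sum_nrm_le_iff[of x I X "nrm (c0_sum I X) x"] by simp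

text \<open>This is the canonical embedding of a summand; accordingly
  \<open>\<lambda>v. f (single i v)\<close> is the component \<open>f\<^sub>i\<close> of a
  functional \<open>f\<close> on the sum.\<close>

definition single :: "'i \<Rightarrow> 'a::real_vector \<Rightarrow> 'i \<Rightarrow> 'a" where
  "single i v = (\<lambda>j. if j = i then v else 0)"

lemma single_same [simp]: "single i v i = v"
  by (simp add: single_def)

lemma single_add: "single i (v + w) = single i v + single i w"
  by (simp add: single_def fun_eq_iff)

lemma single_scaleR: "single i (c *\<^sub>R v) = c *\<^sub>R single i v"
  by (simp add: single_def fun_eq_iff scaleR_fun_apply)

context
  fixes I :: "'i set" and X :: "'i \<Rightarrow> 'a::real_vector nspace"
  assumes X: "\<And>i. i \<in> I \<Longrightarrow> normed_space (X i)"
begin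

lemma c0_sum_zero: "0 \<in> vecs (c0_sum I X)"
  by (auto simp: c0_sum_mem_iff vecs_closed nrm_zero X cong: conj_cong)

lemma c0_sum_add:
  assumes x: "x \<in> vecs (c0_sum I X)" and y: "y \<in> vecs (c0_sum I X)"
  shows "x + y \<in> vecs (c0_sum I X)"
proof -
  have "finite {i \<in> I. e \<le> nrm (X i) (x i + y i)}" if "e > 0" for e
  proof (rule finite_subset)
    show "finite ({i \<in> I. e / 2 \<le> nrm (X i) (x i)} \<union> {i \<in> I. e / 2 \<le> nrm (X i) (y i)})"
      using x y half_gt_zero[OF that] unfolding c0_sum_mem_iff by blast
    have "nrm (X i) (x i + y i) \<le> nrm (X i) (x i) + nrm (X i) (y i)" if "i \<in> I" for i
      using x y that by (intro nrm_triangle X) (auto simp: c0_sum_mem_iff)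
    then show "{i \<in> I. e \<le> nrm (X i) (x i + y i)} \<subseteq>
        {i \<in> I. e / 2 \<le> nrm (X i) (x i)} \<union> {i \<in> I. e / 2 \<le> nrm (X i) (y i)}"
      by fastforce
  qed
  then show ?thesis using x y by (auto simp: c0_sum_mem_iff vecs_closed X)
qed

lemma c0_sum_scaleR:
  assumes x: "x \<in> vecs (c0_sum I X)"
  shows "c *\<^sub>R x \<in> vecs (c0_sum I X)"
proof (cases "c = 0")
  case True
  then show ?thesis using c0_sum_zero by simp
next
  case False
  have "finite {i \<in> I. e \<le> nrm (X i) (c *\<^sub>R x i)}" if "e > 0" for e
  proof (rule finite_subset)
    show "finite {i \<in> I. e / \<bar>c\<bar> \<le> nrm (X i) (x i)}"
      using x that False by (simp add: c0_sum_mem_iff)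
    have "nrm (X i) (c *\<^sub>R x i) = \<bar>c\<bar> * nrm (X i) (x i)" if "i \<in> I" for i
      using x that by (intro nrm_scaleR X) (auto simp: c0_sum_mem_iff)
    then show "{i \<in> I. e \<le> nrm (X i) (c *\<^sub>R x i)} \<subseteq> {i \<in> I. e / \<bar>c\<bar> \<le> nrm (X i) (x i)}"
      using False by (auto simp: field_simps)
  qed
  then show ?thesis using x by (auto simp: c0_sum_mem_iff vecs_closed X scaleR_fun_apply)
qed

lemma c0_sum_normed: "normed_space (c0_sum I X)"
proof -
  let ?C = "c0_sum I X"
  have comp: "x i \<in> vecs (X i)" if "x \<in> vecs ?C" "i \<in> I" for x i
    using that by (simp add: c0_sum_mem_iff)
  have le: "nrm ?C (c *\<^sub>R x) \<le> \<bar>c\<bar> * nrm ?C x" if x: "x \<in> vecs ?C" for c x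
  proof (subst c0_sum_nrm_le_iff)
    show "c *\<^sub>R x \<in> vecs ?C" by (rule c0_sum_scaleR[OF x])
    show "0 \<le> \<bar>c\<bar> * nrm ?C x \<and> (\<forall>i\<in>I. nrm (X i) ((c *\<^sub>R x) i) \<le> \<bar>c\<bar> * nrm ?C x)"
      using c0_sum_nrm_nonneg[OF x] c0_sum_nrm_component[OF x]
      by (auto simp: scaleR_fun_apply nrm_scaleR[OF X comp[OF x]] intro!: mult_left_mono)
  qed
  have "subspace (vecs ?C)"
    using c0_sum_zero c0_sum_add c0_sum_scaleR by (simp add: subspace_def)
  moreover have "nrm ?C x = 0 \<longleftrightarrow> x = 0" if x: "x \<in> vecs ?C" for x
  proof
    assume "nrm ?C x = 0"
    then have "nrm (X i) (x i) = 0" if "i \<in> I" for i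
      using c0_sum_nrm_component[OF x that] nrm_nonneg[OF X[OF that] comp[OF x that]] by simp
    then have "x i = 0" for i
      using nrm_eq_0_iff[OF X comp[OF x]] x by (cases "i \<in> I") (auto simp: c0_sum_mem_iff)
    then show "x = 0" by (simp add: fun_eq_iff)
  next
    assume "x = 0"
    then have "nrm ?C x \<le> 0" using x by (simp add: c0_sum_nrm_le_iff nrm_zero X)
    then show "nrm ?C x = 0" using c0_sum_nrm_nonneg[OF x] by simp
  qed
  moreover have "nrm ?C (c *\<^sub>R x) = \<bar>c\<bar> * nrm ?C x" if x: "x \<in> vecs ?C" for c x
  proof (cases "c = 0")
    case True
    then show ?thesis
      using le[OF x, of c] c0_sum_nrm_nonneg[OF c0_sum_scaleR[OF x], of c] by simp
  next
    case False
    then have "nrm ?C x \<le> (1 / \<bar>c\<bar>) * nrm ?C (c *\<^sub>R x)"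
      using le[OF c0_sum_scaleR[OF x], of "1 / c" c] by simp
    then show ?thesis using le[OF x, of c] False by (simp add: field_simps)
  qed
  moreover have "nrm ?C (x + y) \<le> nrm ?C x + nrm ?C y" if x: "x \<in> vecs ?C" and y: "y \<in> vecs ?C" for x y
  proof (subst c0_sum_nrm_le_iff)
    show "x + y \<in> vecs ?C" by (rule c0_sum_add[OF x y])
    have "nrm (X i) (x i + y i) \<le> nrm ?C x + nrm ?C y" if i: "i \<in> I" for i
      using nrm_triangle[OF X[OF i] comp[OF x i] comp[OF y i]]
        c0_sum_nrm_component[OF x i] c0_sum_nrm_component[OF y i] by simp
    then show "0 \<le> nrm ?C x + nrm ?C y \<and> (\<forall>i\<in>I. nrm (X i) ((x + y) i) \<le> nrm ?C x + nrm ?C y)"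
      using c0_sum_nrm_nonneg[OF x] c0_sum_nrm_nonneg[OF y] by simp
  qed
  ultimately show ?thesis by (simp add: normed_space_def c0_sum_nrm_nonneg)
qed

text \<open>The direction from left to right ensures that components of functionals again vanish
  outside their summand, as the representation of functionals demands.\<close>

lemma single_mem_c0_sum_iff:
  assumes "i \<in> I"
  shows "single i v \<in> vecs (c0_sum I X) \<longleftrightarrow> v \<in> vecs (X i)"
proof
  assume "single i v \<in> vecs (c0_sum I X)"
  then have "single i v i \<in> vecs (X i)" using assms by (simp only: c0_sum_mem_iff)
  then show "v \<in> vecs (X i)" by (simp add: single_def)
next
  assume "v \<in> vecs (X i)"
  then show "single i v \<in> vecs (c0_sum I X)"
    using assms by (intro c0_sum_dominated[OF c0_sum_zero, where S = "{i}"])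
      (auto simp: single_def vecs_closed X)
qed

lemma nrm_single_le:
  assumes "i \<in> I" "v \<in> vecs (X i)"
  shows "nrm (c0_sum I X) (single i v) \<le> nrm (X i) v"
proof (subst c0_sum_nrm_le_iff)
  show "single i v \<in> vecs (c0_sum I X)" using assms by (simp add: single_mem_c0_sum_iff)
  show "0 \<le> nrm (X i) v \<and> (\<forall>j\<in>I. nrm (X j) (single i v j) \<le> nrm (X i) v)"
    using nrm_nonneg[OF X assms(2)] assms(1) by (auto simp: single_def nrm_zero X)
qed

lemma c0_sum_vanish_on:
  assumes "x \<in> vecs (c0_sum I X)"
  shows "(\<lambda>j. if j \<in> S then 0 else x j) \<in> vecs (c0_sum I X)"
  using assms nrm_nonneg[OF X]
  by (intro c0_sum_dominated[OF assms, where S = "{}"]) (auto simp: c0_sum_mem_iff vecs_closed X nrm_zero)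

section \<open>Components of functionals on the sum\<close>

lemma dual_component_mem:
  assumes f: "f \<in> vecs (dual_space (c0_sum I X))" and i: "i \<in> I"
  shows "(\<lambda>v. f (single i v)) \<in> vecs (dual_space (X i))"
proof (rule dual_spaceI[where K = "nrm (dual_space (c0_sum I X)) f"])
  fix v assume v: "v \<in> vecs (X i)"
  have "\<bar>f (single i v)\<bar> \<le> nrm (dual_space (c0_sum I X)) f * nrm (c0_sum I X) (single i v)"
    using v i by (intro dual_abs_le c0_sum_normed f) (auto simp: single_mem_c0_sum_iff)
  also have "\<dots> \<le> nrm (dual_space (c0_sum I X)) f * nrm (X i) v"
    using v i by (intro mult_left_mono nrm_single_le dual_nrm_nonneg c0_sum_normed f)
  finally show "\<bar>f (single i v)\<bar> \<le> nrm (dual_space (c0_sum I X)) f * nrm (X i) v" .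
qed (use f i in \<open>auto simp: single_add single_scaleR single_mem_c0_sum_iff
    dual_space_add[OF f] dual_space_scaleR[OF f] dual_space_outside[OF f]\<close>)

lemma dual_split_finite:
  assumes f: "f \<in> vecs (dual_space (c0_sum I X))" and x: "x \<in> vecs (c0_sum I X)"
    and "finite S" "S \<subseteq> I"
  shows "f x = (\<Sum>i\<in>S. f (single i (x i))) + f (\<lambda>j. if j \<in> S then 0 else x j)"
  using assms(3,4)
proof (induction S)
  case empty
  then show ?case by simp
next
  case (insert i S)
  have "(\<lambda>j. if j \<in> S then 0 else x j) = single i (x i) + (\<lambda>j. if j \<in> insert i S then 0 else x j)"
    using insert(2) by (auto simp: fun_eq_iff single_def)
  moreover have "single i (x i) \<in> vecs (c0_sum I X)"
    using x insert(4) by (simp add: single_mem_c0_sum_iff) (simp add: c0_sum_mem_iff)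
  ultimately have "f (\<lambda>j. if j \<in> S then 0 else x j) =
      f (single i (x i)) + f (\<lambda>j. if j \<in> insert i S then 0 else x j)"
    using dual_space_add[OF f _ c0_sum_vanish_on[OF x, of "insert i S"]] by simp
  then show ?case using insert by simp
qed

text \<open>Removing from \<open>x\<close> the coordinates in \<open>J\<close> and those of norm at
  least \<open>e\<close> leaves a tail of norm at most \<open>e\<close>. The removed coordinates
  outside \<open>J\<close> contribute 0, so the two sides differ by at most a constant times
  \<open>e\<close>.\<close>

lemma dual_eq_sum_components:
  assumes f: "f \<in> vecs (dual_space (c0_sum I X))" and x: "x \<in> vecs (c0_sum I X)"
    and J: "finite J" "J \<subseteq> I"
    and zero: "\<And>i v. i \<in> I \<Longrightarrow> i \<notin> J \<Longrightarrow> f (single i v) = 0"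
  shows "f x = (\<Sum>i\<in>J. f (single i (x i)))"
proof -
  let ?C = "c0_sum I X"
  have bound: "\<bar>f x - (\<Sum>i\<in>J. f (single i (x i)))\<bar> \<le> nrm (dual_space ?C) f * e" if "e > 0" for e
  proof -
    define S where "S = J \<union> {i \<in> I. e \<le> nrm (X i) (x i)}"
    have S: "finite S" "S \<subseteq> I" using x J that by (auto simp: S_def c0_sum_mem_iff)
    let ?r = "\<lambda>j. if j \<in> S then 0 else x j"
    have "(\<Sum>i\<in>S. f (single i (x i))) = (\<Sum>i\<in>J. f (single i (x i)))"
      using S zero by (intro sum.mono_neutral_right) (auto simp: S_def)
    then have "f x - (\<Sum>i\<in>J. f (single i (x i))) = f ?r"
      using dual_split_finite[OF f x S] by simp
    moreover have "nrm ?C ?r \<le> e"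
      using that nrm_zero[OF X] by (subst c0_sum_nrm_le_iff[OF c0_sum_vanish_on[OF x]])
        (auto simp: S_def)
    then have "nrm (dual_space ?C) f * nrm ?C ?r \<le> nrm (dual_space ?C) f * e"
      by (intro mult_left_mono dual_nrm_nonneg c0_sum_normed f)
    ultimately show ?thesis
      using dual_abs_le[OF c0_sum_normed f c0_sum_vanish_on[OF x], of S] by simp
  qed
  have "\<bar>f x - (\<Sum>i\<in>J. f (single i (x i)))\<bar> \<le> 0"
  proof (rule tendsto_lowerbound)
    show "((\<lambda>e. nrm (dual_space ?C) f * e) \<longlongrightarrow> 0) (at_right 0)"
      by (rule tendsto_eq_intros refl | simp)+
    show "\<forall>\<^sub>F e in at_right 0. \<bar>f x - (\<Sum>i\<in>J. f (single i (x i)))\<bar> \<le> nrm (dual_space ?C) f * e"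
      using bound by (auto simp: eventually_at_right_field intro: exI[of _ 1])
  qed simp
  then show ?thesis by simp
qed

text \<open>This is the \<open>\<ell>\<^sub>1\<close> structure of the dual, with one coordinate
  split off from all the others. For the lower bound, vectors with disjoint supports in the unit
  ball have their sum in the unit ball, and signs can be chosen independently so that both
  contributions add up.\<close>

lemma dual_nrm_split:
  assumes f: "f \<in> vecs (dual_space (c0_sum I X))" and i: "i \<in> I"
  shows "nrm (dual_space (c0_sum I X)) f =
    nrm (dual_space (X i)) (\<lambda>v. f (single i v)) + (SUP x\<in>{x\<in>unit_ball (c0_sum I X). x i = 0}. \<bar>f x\<bar>)"
    (is "?N = ?Ni + ?R")
proof (rule antisym)
  let ?C = "c0_sum I X" and ?B = "{x\<in>unit_ball (c0_sum I X). x i = 0}"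
  note fi = dual_component_mem[OF f i]
  show "?N \<le> ?Ni + ?R"
  proof (rule dual_nrm_least[OF c0_sum_normed])
    fix x assume "x \<in> unit_ball ?C"
    then have x: "x \<in> vecs ?C" "nrm ?C x \<le> 1" by (auto simp: unit_ball_def)
    let ?y = "\<lambda>j. if j = i then 0 else x j"
    have y: "?y \<in> vecs ?C" using c0_sum_vanish_on[OF x(1), of "{i}"] by simp
    have "f x = f (single i (x i)) + f ?y"
      using dual_split_finite[OF f x(1), of "{i}"] i by simp
    moreover have "\<bar>f (single i (x i))\<bar> \<le> ?Ni"
      using x i c0_sum_nrm_le_iff[OF x(1), of 1]
      by (intro dual_nrm_upper[OF X[OF i] fi]) (simp add: unit_ball_def c0_sum_mem_iff)
    moreover have "\<bar>f ?y\<bar> \<le> ?R"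
    proof (rule cSUP_upper)
      have "nrm ?C ?y \<le> 1"
        using x(2) nrm_zero[OF X]
        by (simp add: c0_sum_nrm_le_iff[OF y] c0_sum_nrm_le_iff[OF x(1)])
      then show "?y \<in> ?B" using y by (simp add: unit_ball_def)
      show "bdd_above ((\<lambda>x. \<bar>f x\<bar>) ` ?B)"
        by (rule bdd_above_mono[OF dual_space_bdd_above[OF c0_sum_normed f]]) auto
    qed
    ultimately show "\<bar>f x\<bar> \<le> ?Ni + ?R" by linarith
  qed
  have sup: "\<bar>f (single i v)\<bar> + \<bar>f x\<bar> \<le> ?N" if v: "v \<in> unit_ball (X i)" and x: "x \<in> ?B" for v x
  proof -
    \<comment> \<open>A sign may be 0, so only the bound 1 on its absolute value is available; this
      suffices to remain in the unit ball.\<close>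
    define s where "s = sgn (f (single i v))"
    define t where "t = sgn (f x)"
    have st: "\<bar>s\<bar> \<le> 1" "\<bar>t\<bar> \<le> 1" "s * f (single i v) = \<bar>f (single i v)\<bar>" "t * f x = \<bar>f x\<bar>"
      by (auto simp: s_def t_def sgn_if)
    have v': "v \<in> vecs (X i)" "nrm (X i) v \<le> 1" and x': "x \<in> vecs ?C" "nrm ?C x \<le> 1" "x i = 0"
      using v x by (auto simp: unit_ball_def)
    have m: "single i v \<in> vecs ?C" using v' i by (simp add: single_mem_c0_sum_iff)
    let ?y = "s *\<^sub>R single i v + t *\<^sub>R x"
    have y: "?y \<in> vecs ?C" by (intro c0_sum_add c0_sum_scaleR m x')
    have "nrm (X j) (?y j) \<le> 1" if j: "j \<in> I" for j
    proof (cases "j = i")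
      case True
      then show ?thesis
        using x'(3) v' st(1) nrm_nonneg[OF X[OF i] v'(1)]
        by (simp add: single_def scaleR_fun_apply nrm_scaleR[OF X[OF i]] mult_le_one)
    next
      case False
      have xj: "x j \<in> vecs (X j)" "nrm (X j) (x j) \<le> 1"
        using x' j c0_sum_nrm_le_iff[OF x'(1), of 1] by (auto simp: c0_sum_mem_iff)
      then show ?thesis
        using False st(2) nrm_nonneg[OF X[OF j] xj(1)]
        by (simp add: single_def scaleR_fun_apply nrm_scaleR[OF X[OF j]] mult_le_one)
    qed
    then have "?y \<in> unit_ball ?C" using y by (simp add: unit_ball_def c0_sum_nrm_le_iff)
    moreover have "f ?y = \<bar>f (single i v)\<bar> + \<bar>f x\<bar>"
      using st by (simp add: dual_space_add[OF f] dual_space_scaleR[OF f] c0_sum_scaleR m x')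
    ultimately show ?thesis using dual_nrm_upper[OF c0_sum_normed f, of ?y] by simp
  qed
  \<comment> \<open>The two suprema are taken one after the other: first over \<open>x\<close> for
    fixed \<open>v\<close>, then over \<open>v\<close>.\<close>
  have "?Ni \<le> ?N - ?R"
  proof (rule dual_nrm_least[OF X[OF i]])
    fix v assume v: "v \<in> unit_ball (X i)"
    have "?R \<le> ?N - \<bar>f (single i v)\<bar>"
    proof (rule cSUP_least)
      have "0 \<in> ?B" using zero_in_unit_ball[OF c0_sum_normed] by simp
      then show "?B \<noteq> {}" by blast
    qed (use sup[OF v] in fastforce)
    then show "\<bar>f (single i v)\<bar> \<le> ?N - ?R" by simp
  qed
  then show "?Ni + ?R \<le> ?N" by simp
qed

section \<open>SSD-points of the dual of the sum\<close>

text \<open>This is the adjoint of the coordinate projection; the second branch keeps the convention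
  that functionals vanish outside their space.\<close>

definition lift_dual :: "'i \<Rightarrow> ('a \<Rightarrow> real) \<Rightarrow> ('i \<Rightarrow> 'a) \<Rightarrow> real" where
  "lift_dual i g = (\<lambda>x. if x \<in> vecs (c0_sum I X) then g (x i) else 0)"

lemma lift_dual_unit_ball:
  assumes i: "i \<in> I" and g: "g \<in> unit_ball (dual_space (X i))"
  shows "lift_dual i g \<in> unit_ball (dual_space (c0_sum I X))"
proof -
  let ?C = "c0_sum I X"
  have g': "g \<in> vecs (dual_space (X i))" "nrm (dual_space (X i)) g \<le> 1"
    using g by (auto simp: unit_ball_def)
  have comp: "x i \<in> vecs (X i)" if "x \<in> vecs ?C" for x using that i by (simp add: c0_sum_mem_iff)
  have bound: "\<bar>lift_dual i g x\<bar> \<le> 1 * nrm ?C x" if x: "x \<in> vecs ?C" for x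
  proof -
    have "\<bar>g (x i)\<bar> \<le> nrm (dual_space (X i)) g * nrm (X i) (x i)"
      by (rule dual_abs_le[OF X[OF i] g'(1) comp[OF x]])
    also have "\<dots> \<le> 1 * nrm ?C x"
      using g'(2) c0_sum_nrm_component[OF x i] nrm_nonneg[OF X[OF i] comp[OF x]]
      by (intro mult_mono) auto
    finally show ?thesis using x by (simp add: lift_dual_def)
  qed
  have "lift_dual i g \<in> vecs (dual_space ?C)"
    by (rule dual_spaceI[where K = 1])
      (use bound in \<open>auto simp: lift_dual_def comp c0_sum_add c0_sum_scaleR scaleR_fun_apply
        dual_space_add[OF g'(1)] dual_space_scaleR[OF g'(1)]\<close>)
  moreover have "nrm (dual_space ?C) (lift_dual i g) \<le> 1"
    using bound by (intro dual_nrm_least c0_sum_normed) (fastforce simp: unit_ball_def)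
  ultimately show ?thesis by (simp add: unit_ball_def)
qed

text \<open>A perturbation along a lifted functional changes only one component, so the contribution
  of the other coordinates in \<open>dual_nrm_split\<close> cancels.\<close>

lemma dual_nrm_lift_diff:
  assumes f: "f \<in> vecs (dual_space (c0_sum I X))" and i: "i \<in> I"
    and g: "g \<in> unit_ball (dual_space (X i))"
  shows "nrm (dual_space (c0_sum I X)) (f + t *\<^sub>R lift_dual i g) - nrm (dual_space (c0_sum I X)) f =
    nrm (dual_space (X i)) ((\<lambda>v. f (single i v)) + t *\<^sub>R g)
      - nrm (dual_space (X i)) (\<lambda>v. f (single i v))"
proof -
  let ?C = "c0_sum I X"
  let ?h = "f + t *\<^sub>R lift_dual i g"
  have g': "g \<in> vecs (dual_space (X i))" using g by (simp add: unit_ball_def)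
  have h: "?h \<in> vecs (dual_space ?C)"
    using lift_dual_unit_ball[OF i g] f
    by (intro vecs_closed dual_space_subspace subspace_add subspace_scale c0_sum_normed)
      (simp_all add: unit_ball_def)
  have "(\<lambda>v. ?h (single i v)) = (\<lambda>v. f (single i v)) + t *\<^sub>R g"
    using dual_space_outside[OF g']
    by (auto simp: fun_eq_iff scaleR_fun_apply lift_dual_def single_mem_c0_sum_iff[OF i])
  moreover have "?h x = f x" if "x i = 0" for x
    using dual_space_zero[OF X[OF i] g'] that by (simp add: scaleR_fun_apply lift_dual_def)
  then have "(SUP x\<in>{x\<in>unit_ball ?C. x i = 0}. \<bar>?h x\<bar>) = (SUP x\<in>{x\<in>unit_ball ?C. x i = 0}. \<bar>f x\<bar>)"
    by (intro SUP_cong) auto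
  ultimately show ?thesis using dual_nrm_split[OF h i] dual_nrm_split[OF f i] by simp
qed

text \<open>The difference quotients of the component in direction \<open>h\<close> are those of
  \<open>f\<close> in direction \<open>lift_dual i h\<close>. Lifting maps unit ball into unit ball,
  so uniformity is inherited.\<close>

lemma SSD_point_component:
  assumes "SSD_point (dual_space (c0_sum I X)) f" and i: "i \<in> I"
  shows "SSD_point (dual_space (X i)) (\<lambda>v. f (single i v))"
proof -
  let ?D = "dual_space (c0_sum I X)" and ?Di = "dual_space (X i)"
  obtain D where f: "f \<in> vecs ?D"
    and lim: "uniform_limit (unit_ball ?D) (\<lambda>t h. (nrm ?D (f + t *\<^sub>R h) - nrm ?D f) / t) D (at_right 0)"
    using assms(1) by (auto simp: SSD_point_def)
  have "uniform_limit (unit_ball ?Di) (\<lambda>t h. (nrm ?Di ((\<lambda>v. f (single i v)) + t *\<^sub>R h)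
      - nrm ?Di (\<lambda>v. f (single i v))) / t) (\<lambda>h. D (lift_dual i h)) (at_right 0)"
    unfolding uniform_limit_iff
  proof (intro allI impI)
    fix e :: real assume "e > 0"
    then have "\<forall>\<^sub>F t in at_right 0. \<forall>h\<in>unit_ball ?D.
        dist ((nrm ?D (f + t *\<^sub>R h) - nrm ?D f) / t) (D h) < e"
      using lim by (simp add: uniform_limit_iff)
    then show "\<forall>\<^sub>F t in at_right 0. \<forall>h\<in>unit_ball ?Di. dist ((nrm ?Di ((\<lambda>v. f (single i v)) + t *\<^sub>R h)
      - nrm ?Di (\<lambda>v. f (single i v))) / t) (D (lift_dual i h)) < e"
      by eventually_elim (use lift_dual_unit_ball[OF i] dual_nrm_lift_diff[OF f i] in fastforce)
  qed
  then show ?thesis using dual_component_mem[OF f i] by (auto simp: SSD_point_def)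
qed

text \<open>In the direction of \<open>-f\<^sub>i/\<parallel>f\<^sub>i\<parallel>\<close> the difference quotient at step \<open>t\<close> is
  \<open>(\<bar>c - t\<bar> - c)/t\<close> with \<open>c = \<parallel>f\<^sub>i\<parallel>\<close>, which is \<open>-1\<close> at \<open>t = c\<close> but \<open>1/3\<close> at \<open>t = 3c\<close>;
  uniformity therefore keeps the nonzero \<open>c\<close> away from \<open>0\<close>.\<close>

lemma SSD_point_components_away_from_0:
  assumes "SSD_point (dual_space (c0_sum I X)) f"
  obtains d where "d > 0"
    "\<And>i. i \<in> I \<Longrightarrow> (\<lambda>v. f (single i v)) \<noteq> 0 \<Longrightarrow> d \<le> nrm (dual_space (X i)) (\<lambda>v. f (single i v))"
proof -
  let ?D = "dual_space (c0_sum I X)"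
  obtain D where f: "f \<in> vecs ?D"
    and lim: "uniform_limit (unit_ball ?D) (\<lambda>t h. (nrm ?D (f + t *\<^sub>R h) - nrm ?D f) / t) D (at_right 0)"
    using assms by (auto simp: SSD_point_def)
  have "\<forall>\<^sub>F t in at_right 0. \<forall>h\<in>unit_ball ?D.
      dist ((nrm ?D (f + t *\<^sub>R h) - nrm ?D f) / t) (D h) < 1 / 6"
    using lim[unfolded uniform_limit_iff, rule_format, of "1 / 6"] by simp
  then obtain b where b: "b > 0" and near: "\<And>t h. 0 < t \<Longrightarrow> t < b \<Longrightarrow> h \<in> unit_ball ?D \<Longrightarrow>
      dist ((nrm ?D (f + t *\<^sub>R h) - nrm ?D f) / t) (D h) < 1 / 6"
    by (auto simp: eventually_at_right_field)
  \<comment> \<open>Below \<open>b / 3\<close> both steps, the norm of the component and three times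
    it, would be smaller than \<open>b\<close>. Then \<open>- 1\<close> and \<open>1 / 3\<close>
    would both be within \<open>1 / 6\<close> of the same limit value.\<close>
  have "b / 3 \<le> nrm (dual_space (X i)) (\<lambda>v. f (single i v))"
    if i: "i \<in> I" and nz: "(\<lambda>v. f (single i v)) \<noteq> 0" for i
  proof (rule ccontr)
    define g where "g = (\<lambda>v. f (single i v))"
    let ?N = "nrm (dual_space (X i))"
    have g: "g \<in> vecs (dual_space (X i))" unfolding g_def by (rule dual_component_mem[OF f i])
    assume "\<not> b / 3 \<le> ?N (\<lambda>v. f (single i v))"
    then have small: "3 * ?N g < b" by (simp add: g_def)
    have "?N g \<noteq> 0"
    proof
      assume 0: "?N g = 0"
      have "g v = 0" for v
        using dual_abs_le[OF X[OF i] g, of v] dual_space_outside[OF g, of v] 0 by fastforce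
      then show False using nz by (auto simp: g_def fun_eq_iff)
    qed
    then have pos: "?N g > 0" using dual_nrm_nonneg[OF X[OF i] g] by simp
    define h where "h = (- 1 / ?N g) *\<^sub>R g"
    have h: "h \<in> unit_ball (dual_space (X i))"
      using pos dual_nrm_scaleR[OF X[OF i] g, of "- 1 / ?N g"]
        subspace_scale[OF dual_space_subspace[OF X[OF i]] g, of "- 1 / ?N g"]
      by (simp add: unit_ball_def h_def)
    have quot: "nrm ?D (f + t *\<^sub>R lift_dual i h) - nrm ?D f = \<bar>1 - t / ?N g\<bar> * ?N g - ?N g" for t
    proof -
      have "g + t *\<^sub>R h = (1 - t / ?N g) *\<^sub>R g"
        by (simp add: h_def algebra_simps)
      then show ?thesis
        using dual_nrm_lift_diff[OF f i h, of t] dual_nrm_scaleR[OF X[OF i] g] by (simp add: g_def)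
    qed
    have q1: "(nrm ?D (f + ?N g *\<^sub>R lift_dual i h) - nrm ?D f) / ?N g = - 1"
      using pos by (simp add: quot)
    have q3: "(nrm ?D (f + (3 * ?N g) *\<^sub>R lift_dual i h) - nrm ?D f) / (3 * ?N g) = 1 / 3"
      using pos by (simp add: quot)
    have "dist (- 1) (D (lift_dual i h)) < 1 / 6"
      using near[of "?N g", OF _ _ lift_dual_unit_ball[OF i h]] pos small q1 by simp
    moreover have "dist (1 / 3) (D (lift_dual i h)) < 1 / 6"
      using near[of "3 * ?N g", OF _ _ lift_dual_unit_ball[OF i h]] pos small q3 by simp
    ultimately show False unfolding dist_real_def by linarith
  qed
  then show thesis using that[of "b / 3"] b by simp
qed

text \<open>From \<open>n\<close> components of norm at least \<open>d\<close> one assembles a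
  vector of the unit ball on which \<open>f\<close> is at least \<open>n * (d / 2)\<close>. This
  contradicts boundedness of \<open>f\<close> once \<open>n\<close> exceeds
  \<open>2 * ?N / d\<close>.\<close>

lemma finite_large_components:
  assumes f: "f \<in> vecs (dual_space (c0_sum I X))" and d: "d > 0"
  shows "finite {i \<in> I. d \<le> nrm (dual_space (X i)) (\<lambda>v. f (single i v))}" (is "finite ?L")
proof (rule ccontr)
  let ?C = "c0_sum I X"
  let ?N = "nrm (dual_space ?C) f"
  assume inf: "infinite ?L"
  obtain n :: nat where n: "2 * ?N / d < n" using reals_Archimedean2 by blast
  obtain S where S: "finite S" "card S = n" "S \<subseteq> ?L"
    using infinite_arbitrarily_large[OF inf] by blast
  \<comment> \<open>The norm of a component need not be attained, hence the loss of a factor 2.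
    Symmetry of the unit ball removes the absolute value.\<close>
  have "\<exists>v\<in>unit_ball (X i). d / 2 < f (single i v)" if "i \<in> S" for i
  proof (rule ccontr)
    have i: "i \<in> I" "d \<le> nrm (dual_space (X i)) (\<lambda>v. f (single i v))" using that S by auto
    assume neg: "\<not> ?thesis"
    have "\<bar>f (single i v)\<bar> \<le> d / 2" if v: "v \<in> unit_ball (X i)" for v
    proof -
      have "- v \<in> unit_ball (X i)"
        using v by (simp add: unit_ball_def vecs_closed X[OF i(1)] nrm_minus)
      moreover have "f (single i (- v)) = - f (single i v)"
        using dual_space_scaleR[OF dual_component_mem[OF f i(1)], of v "- 1"] v
        by (simp add: unit_ball_def)
      moreover have "f (single i y) \<le> d / 2" if "y \<in> unit_ball (X i)" for y
        using neg that by (auto simp: not_less)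
      from this[of v] this[of "- v"] calculation show ?thesis using v by (simp add: abs_le_iff)
    qed
    then have "nrm (dual_space (X i)) (\<lambda>v. f (single i v)) \<le> d / 2"
      by (rule dual_nrm_least[OF X[OF i(1)]])
    then show False using i d by simp
  qed
  then obtain v where v: "\<And>i. i \<in> S \<Longrightarrow> v i \<in> unit_ball (X i)"
    and v_gt: "\<And>i. i \<in> S \<Longrightarrow> d / 2 < f (single i (v i))" by metis
  define x where "x = (\<lambda>i. if i \<in> S then v i else 0)"
  have x: "x \<in> vecs ?C"
    using v S by (intro c0_sum_dominated[OF c0_sum_zero S(1)])
      (auto simp: x_def unit_ball_def vecs_closed X)
  have "nrm ?C x \<le> 1"
    unfolding c0_sum_nrm_le_iff[OF x] using v by (auto simp: x_def unit_ball_def nrm_zero X)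
  then have "f x \<le> ?N" using dual_nrm_upper[OF c0_sum_normed f, of x] x by (simp add: unit_ball_def)
  moreover have "(\<lambda>j. if j \<in> S then 0 else x j) = 0" by (auto simp: x_def fun_eq_iff)
  then have "f x = (\<Sum>i\<in>S. f (single i (x i)))"
    using dual_split_finite[OF f x S(1)] S(3) dual_space_zero[OF c0_sum_normed f] by auto
  then have "f x = (\<Sum>i\<in>S. f (single i (v i)))" by (simp add: x_def)
  moreover have "(\<Sum>i\<in>S. d / 2) \<le> (\<Sum>i\<in>S. f (single i (v i)))"
    using v_gt by (intro sum_mono) (auto intro: less_imp_le)
  ultimately have "n * (d / 2) \<le> ?N" using S(2) by simp
  then show False using n d by (simp add: field_simps)
qed

text \<open>The nonzero components have norms bounded below by one positive number, and only
  finitely many components can be that large.\<close>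

lemma SSD_point_finite_support:
  assumes f: "SSD_point (dual_space (c0_sum I X)) f"
  shows "finite {i \<in> I. (\<lambda>v. f (single i v)) \<noteq> 0}"
proof -
  obtain d where d: "d > 0"
    "\<And>i. i \<in> I \<Longrightarrow> (\<lambda>v. f (single i v)) \<noteq> 0 \<Longrightarrow> d \<le> nrm (dual_space (X i)) (\<lambda>v. f (single i v))"
    using SSD_point_components_away_from_0[OF f] by blast
  have "finite {i \<in> I. d \<le> nrm (dual_space (X i)) (\<lambda>v. f (single i v))}"
    using f d(1) by (intro finite_large_components) (simp_all add: SSD_point_def)
  then show ?thesis by (rule rev_finite_subset) (use d(2) in auto)
qed

section \<open>Gluing the coordinates into a best approximation\<close>

text \<open>The values of the components are fixed in the limit separately on each coordinate of
  \<open>J\<close>. Since these limits still sum to \<open>f x\<close>, vectors found independently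
  in the summands can be glued without leaving the affine subspace where the functionals in
  \<open>F\<close> agree with \<open>x\<close>.\<close>

lemma minimizing_subsequence_near_metric_proj:
  assumes F: "finite F" "F \<subseteq> vecs (dual_space (c0_sum I X))"
    and J: "finite J" "J \<subseteq> I"
    and zero: "\<And>f i v. f \<in> F \<Longrightarrow> i \<in> I \<Longrightarrow> i \<notin> J \<Longrightarrow> f (single i v) = 0"
    and sp: "\<And>i. i \<in> J \<Longrightarrow> strongly_proximinal (common_kernel (X i) ((\<lambda>f v. f (single i v)) ` F)) (X i)"
    and x: "x \<in> vecs (c0_sum I X) - common_kernel (c0_sum I X) F"
    and y: "\<And>n. y n \<in> common_kernel (c0_sum I X) F"
    and lim: "(\<lambda>n. nrm (c0_sum I X) (x - y n)) \<longlonglongrightarrow> set_dist (c0_sum I X) x (common_kernel (c0_sum I X) F)"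
  shows "\<exists>s. strict_mono s \<and> (\<forall>e>0. \<forall>\<^sub>F n in sequentially.
    \<exists>z\<in>metric_proj (c0_sum I X) (common_kernel (c0_sum I X) F) x. nrm (c0_sum I X) (y (s n) - z) < e)"
proof -
  let ?C = "c0_sum I X"
  let ?Y = "common_kernel ?C F"
  note C = c0_sum_normed
  define d where "d = set_dist ?C x ?Y"
  define u where "u n = x - y n" for n
  have Fd: "f \<in> vecs (dual_space ?C)" if "f \<in> F" for f using F that by auto
  have Y: "?Y \<subseteq> vecs ?C" by (auto simp: common_kernel_def)
  have yC: "y n \<in> vecs ?C" for n using y Y by blast
  have u: "u n \<in> vecs ?C" for n using x yC by (simp add: u_def vecs_closed C)
  have ui: "u n i \<in> vecs (X i)" if "i \<in> I" for n i using u[of n] that by (simp add: c0_sum_mem_iff)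
  have fu: "f (u n) = f x" if "f \<in> F" for f n
    using dual_space_diff[OF C Fd[OF that] _ yC, of x n] x y[of n] that
    by (simp add: u_def common_kernel_def)
  have u_lim: "(\<lambda>n. nrm ?C (u n)) \<longlonglongrightarrow> d" using lim by (simp add: u_def d_def)
  \<comment> \<open>If \<open>d\<close> were 0, the sequence \<open>y\<close> would converge to
    \<open>x\<close>, which would then belong to the closed subspace.\<close>
  have d: "d > 0"
  proof -
    have "d \<noteq> 0"
    proof
      assume "d = 0"
      then have "(\<lambda>n. nrm ?C (y n - x)) \<longlonglongrightarrow> 0"
        using u_lim nrm_minus_commute[OF C yC, of x] x by (simp add: u_def)
      then show False
        using common_kernel_closed[OF C F(2)] x y unfolding closed_subspace_def by blast
    qed
    moreover have "0 \<le> d"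
      using u_lim c0_sum_nrm_nonneg[OF u] by (intro LIMSEQ_le_const[OF u_lim]) auto
    ultimately show ?thesis by simp
  qed
  obtain B where B: "\<And>n. nrm ?C (u n) \<le> B"
    using convergent_imp_Bseq[OF convergentI[OF u_lim]] by (auto simp: Bseq_def abs_le_iff)
  have "bounded (range (\<lambda>n. f (single i (u n i))))" if "f \<in> F" "i \<in> J" for f i
  proof (rule boundedI)
    fix a assume "a \<in> range (\<lambda>n. f (single i (u n i)))"
    then obtain n where a: "a = f (single i (u n i))" by auto
    have i: "i \<in> I" using that J by auto
    have m: "single i (u n i) \<in> vecs ?C" by (simp add: single_mem_c0_sum_iff i ui)
    have "\<bar>a\<bar> \<le> nrm (dual_space ?C) f * nrm ?C (single i (u n i))"
      unfolding a by (rule dual_abs_le[OF C Fd[OF that(1)] m])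
    also have "nrm ?C (single i (u n i)) \<le> B"
      using nrm_single_le[OF i ui[OF i]] c0_sum_nrm_component[OF u i, of n] B[of n] by (meson order_trans)
    then have "nrm (dual_space ?C) f * nrm ?C (single i (u n i)) \<le> nrm (dual_space ?C) f * B"
      by (intro mult_left_mono dual_nrm_nonneg C Fd that)
    finally show "norm a \<le> nrm (dual_space ?C) f * B" by simp
  qed
  then have "bounded (range (\<lambda>n. fst p (single (snd p) (u n (snd p)))))" if "p \<in> F \<times> J" for p
    using that by (simp add: mem_Times_iff)
  then obtain s where s: "strict_mono s"
    and conv': "\<And>p. p \<in> F \<times> J \<Longrightarrow> convergent (\<lambda>n. fst p (single (snd p) (u (s n) (snd p))))"
    using finite_family_convergent_subseq[of "F \<times> J" "\<lambda>p n. fst p (single (snd p) (u n (snd p)))"]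
      finite_cartesian_product[OF F(1) J(1)] by blast
  have conv: "convergent (\<lambda>n. f (single i (u (s n) i)))" if "f \<in> F" "i \<in> J" for f i
    using conv'[of "(f, i)"] that by simp
  \<comment> \<open>The limit is indexed by the component \<open>g\<close> and not by
    \<open>f\<close>, because distinct members of \<open>F\<close> may have the same component in a
    given summand.\<close>
  define w where "w i g = Lim sequentially (\<lambda>n. g (u (s n) i))" for i and g :: "'a \<Rightarrow> real"
  have w: "(\<lambda>n. f (single i (u (s n) i))) \<longlonglongrightarrow> w i (\<lambda>v. f (single i v))" if "f \<in> F" "i \<in> J" for f i
    using conv[OF that] by (simp add: w_def convergent_LIMSEQ_iff lim_def[symmetric])
  have sum_w: "(\<Sum>i\<in>J. w i (\<lambda>v. f (single i v))) = f x" if f: "f \<in> F" for f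
  proof (rule LIMSEQ_unique)
    show "(\<lambda>n. \<Sum>i\<in>J. f (single i (u (s n) i))) \<longlonglongrightarrow> (\<Sum>i\<in>J. w i (\<lambda>v. f (single i v)))"
      using w[OF f] by (intro tendsto_sum)
    have "(\<Sum>i\<in>J. f (single i (u (s n) i))) = f x" for n
      using dual_eq_sum_components[OF Fd[OF f] u J zero[OF f]] fu[OF f] by simp
    then show "(\<lambda>n. \<Sum>i\<in>J. f (single i (u (s n) i))) \<longlonglongrightarrow> f x" by simp
  qed
  have us_le: "\<forall>\<^sub>F n in sequentially. nrm ?C (u (s n)) < d + e" if "e > 0" for e
    using order_tendstoD(2)[OF LIMSEQ_subseq_LIMSEQ[OF u_lim s], of "d + e"] that by (simp add: o_def)
  have "\<forall>\<^sub>F n in sequentially. \<exists>z\<in>metric_proj ?C ?Y x. nrm ?C (y (s n) - z) < e" if e: "e > 0" for e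
  proof -
    have "\<forall>\<^sub>F n in sequentially. \<exists>z\<in>vecs (X i). (\<forall>g\<in>(\<lambda>f v. f (single i v)) ` F. g z = w i g) \<and>
        nrm (X i) z \<le> d \<and> nrm (X i) (u (s n) i - z) < e / 2" if i: "i \<in> J" for i
    proof (rule eventually_near_metric_fibre[OF X _ _ sp[OF i] d])
      show iI: "i \<in> I" using i J by auto
      show "(\<lambda>f v. f (single i v)) ` F \<subseteq> vecs (dual_space (X i))"
        using dual_component_mem[OF Fd iI] by auto
      show "u (s n) i \<in> vecs (X i)" for n by (rule ui[OF iI])
      show "\<forall>\<^sub>F n in sequentially. nrm (X i) (u (s n) i) < d + a" if "a > 0" for a
        using us_le[OF that]
        by eventually_elim (use c0_sum_nrm_component[OF u iI] in \<open>rule le_less_trans\<close>)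
      show "(\<lambda>n. g (u (s n) i)) \<longlonglongrightarrow> w i g" if "g \<in> (\<lambda>f v. f (single i v)) ` F" for g
        using that w[OF _ i] by auto
    qed (use F e in auto)
    then have "\<forall>\<^sub>F n in sequentially. \<forall>i\<in>J. \<exists>z\<in>vecs (X i).
        (\<forall>g\<in>(\<lambda>f v. f (single i v)) ` F. g z = w i g) \<and>
        nrm (X i) z \<le> d \<and> nrm (X i) (u (s n) i - z) < e / 2"
      by (intro eventually_ball_finite J(1) ballI)
    then show ?thesis using us_le[OF half_gt_zero[OF e]]
    proof eventually_elim
      case (elim n)
      have "\<exists>z. z \<in> vecs (X i) \<and> (\<forall>f\<in>F. f (single i z) = w i (\<lambda>v. f (single i v))) \<and>
          nrm (X i) z \<le> d \<and> nrm (X i) (u (s n) i - z) < e / 2" if "i \<in> J" for i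
        using bspec[OF elim(1) that] by auto
      then have "\<forall>i\<in>J. \<exists>z. z \<in> vecs (X i) \<and> (\<forall>f\<in>F. f (single i z) = w i (\<lambda>v. f (single i v))) \<and>
          nrm (X i) z \<le> d \<and> nrm (X i) (u (s n) i - z) < e / 2" by (rule ballI)
      from bchoice[OF this] obtain zJ where zJ':
        "\<forall>i\<in>J. zJ i \<in> vecs (X i) \<and> (\<forall>f\<in>F. f (single i (zJ i)) = w i (\<lambda>v. f (single i v))) \<and>
          nrm (X i) (zJ i) \<le> d \<and> nrm (X i) (u (s n) i - zJ i) < e / 2" ..
      have zJ: "zJ i \<in> vecs (X i)" "\<forall>f\<in>F. f (single i (zJ i)) = w i (\<lambda>v. f (single i v))"
        "nrm (X i) (zJ i) \<le> d" "nrm (X i) (u (s n) i - zJ i) < e / 2" if "i \<in> J" for i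
        using bspec[OF zJ' that] by simp_all
      \<comment> \<open>Scaling by \<open>c = d / N\<close> brings every coordinate to norm at most
        \<open>d\<close>. It displaces a coordinate by at most \<open>(1 - c) * N = N - d\<close>,
        which is less than \<open>e / 2\<close>.\<close>
      define N where "N = max d (nrm ?C (u (s n)))"
      define c where "c = d / N"
      have N: "N > 0" "d \<le> N" "N < d + e / 2" "nrm ?C (u (s n)) \<le> N"
        using d e elim by (auto simp: N_def)
      have c: "0 \<le> c" "c \<le> 1" "c * N = d" using N d by (auto simp: c_def field_simps)
      define z where "z i = (if i \<in> J then zJ i else c *\<^sub>R u (s n) i)" for i
      have uN: "nrm (X i) (u (s n) i) \<le> N" if "i \<in> I" for i
        using c0_sum_nrm_component[OF u that, of "s n"] N(4) by simp
      have zi: "z i \<in> vecs (X i)" if "i \<in> I" for i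
        using zJ(1) ui[OF that] by (simp add: z_def vecs_closed X that)
      have z: "z \<in> vecs ?C"
      proof (rule c0_sum_dominated[OF u J(1)])
        show "z i = 0" if "i \<notin> I" for i
          using that J u[of "s n"] by (auto simp: z_def c0_sum_mem_iff)
        show "nrm (X i) (z i) \<le> nrm (X i) (u (s n) i)" if "i \<in> I" "i \<notin> J" for i
          using that c(1,2) nrm_nonneg[OF X[OF that(1)] ui[OF that(1)]]
          by (simp add: z_def nrm_scaleR[OF X ui] mult_left_le_one_le)
      qed (rule zi)
      have z_le: "nrm ?C z \<le> d"
      proof (unfold c0_sum_nrm_le_iff[OF z], intro conjI ballI)
        fix i assume i: "i \<in> I"
        show "nrm (X i) (z i) \<le> d"
        proof (cases "i \<in> J")
          case True
          then show ?thesis using zJ(3) by (simp add: z_def)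
        next
          case False
          then show ?thesis
            using mult_left_mono[OF uN[OF i] c(1)] c by (simp add: z_def nrm_scaleR[OF X ui] i)
        qed
      qed (use d in simp)
      have fz: "f z = f x" if f: "f \<in> F" for f
      proof -
        have "(\<Sum>i\<in>J. f (single i (z i))) = (\<Sum>i\<in>J. w i (\<lambda>v. f (single i v)))"
          using bspec[OF zJ(2) f] by (intro sum.cong) (simp_all add: z_def)
        then show ?thesis
          using dual_eq_sum_components[OF Fd[OF f] z J zero[OF f]] sum_w[OF f] by simp
      qed
      have xC: "x \<in> vecs ?C" using x by simp
      have xz: "x - z \<in> ?Y"
        unfolding common_kernel_diff_eq[OF C F(2) xC z] by (intro ballI fz[symmetric])
      have "x - (x - z) = z" by simp
      \<comment> \<open>Since \<open>x - z\<close> lies in the kernel, the norm of \<open>z\<close>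
        is at least the distance \<open>d\<close>; with \<open>z_le\<close> it equals
        \<open>d\<close>, so \<open>x - z\<close> is a best approximation.\<close>
      then have "d = nrm ?C (x - (x - z))"
        using set_dist_lower[OF C Y xC xz] z_le by (simp add: d_def)
      then have mp: "x - z \<in> metric_proj ?C ?Y x" using xz by (simp add: metric_proj_def d_def)
      have uz: "u (s n) - z \<in> vecs ?C" by (intro vecs_closed C u z)
      have "nrm ?C (u (s n) - z) \<le> e / 2"
      proof (unfold c0_sum_nrm_le_iff[OF uz], intro conjI ballI)
        fix i assume i: "i \<in> I"
        show "nrm (X i) ((u (s n) - z) i) \<le> e / 2"
        proof (cases "i \<in> J")
          case True
          then show ?thesis using zJ(4) by (simp add: z_def less_imp_le)
        next
          case False
          then have "(u (s n) - z) i = (1 - c) *\<^sub>R u (s n) i" by (simp add: z_def algebra_simps)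
          then have "nrm (X i) ((u (s n) - z) i) = (1 - c) * nrm (X i) (u (s n) i)"
            using c by (simp add: nrm_scaleR[OF X ui] i)
          also have "\<dots> \<le> (1 - c) * N" using c by (intro mult_left_mono uN i) auto
          also have "\<dots> \<le> e / 2" using c(3) N(3) by (simp add: algebra_simps)
          finally show ?thesis .
        qed
      qed (use e in simp)
      moreover have eq: "y (s n) - (x - z) = - (u (s n) - z)" by (simp add: u_def)
      have "nrm ?C (y (s n) - (x - z)) = nrm ?C (u (s n) - z)"
        unfolding eq by (rule nrm_minus[OF C uz])
      ultimately have "nrm ?C (y (s n) - (x - z)) < e" using e by simp
      then show ?case using mp by blast
    qed
  qed
  then show ?thesis using s by blast
qed

end

theorem theorem2p22:
  fixes I :: "'i set" and X :: "'i \<Rightarrow> 'a::real_vector nspace"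
  assumes "\<And>i. i \<in> I \<Longrightarrow> banach_space (X i)"
    and "\<And>i F. i \<in> I \<Longrightarrow> finite F \<Longrightarrow> (\<And>f. f \<in> F \<Longrightarrow> SSD_point (dual_space (X i)) f) \<Longrightarrow>
           strongly_proximinal (common_kernel (X i) F) (X i)"
  shows "\<And>F. finite F \<Longrightarrow> (\<And>f. f \<in> F \<Longrightarrow> SSD_point (dual_space (c0_sum I X)) f) \<Longrightarrow>
           strongly_proximinal (common_kernel (c0_sum I X) F) (c0_sum I X)"
proof -
  fix F :: "(('i \<Rightarrow> 'a) \<Rightarrow> real) set"
  assume F: "finite F" and ssd: "\<And>f. f \<in> F \<Longrightarrow> SSD_point (dual_space (c0_sum I X)) f"
  have X: "normed_space (X i)" if "i \<in> I" for i
    using assms(1)[OF that] by (simp add: banach_space_def)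
  have Fd: "F \<subseteq> vecs (dual_space (c0_sum I X))" using ssd by (auto simp: SSD_point_def)
  define J where "J = (\<Union>f\<in>F. {i \<in> I. (\<lambda>v. f (single i v)) \<noteq> 0})"
  have J: "finite J" "J \<subseteq> I"
    using F SSD_point_finite_support[of I X, OF X ssd] by (auto simp: J_def)
  have zero: "f (single i v) = 0" if "f \<in> F" "i \<in> I" "i \<notin> J" for f i v
  proof -
    have "(\<lambda>v. f (single i v)) = 0" using that by (auto simp: J_def)
    then show ?thesis by (simp add: fun_eq_iff)
  qed
  \<comment> \<open>For \<open>i\<close> in \<open>J\<close> some members of \<open>F\<close> may
    have component 0 there. This is harmless, as \<open>SSD_point_component\<close> covers zero
    components too.\<close>
  have sp: "strongly_proximinal (common_kernel (X i) ((\<lambda>f v. f (single i v)) ` F)) (X i)"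
    if "i \<in> J" for i
  proof -
    have i: "i \<in> I" using that J by auto
    then show ?thesis
      using F SSD_point_component[of I X, OF X ssd i] by (intro assms(2)) auto
  qed
  have C: "normed_space (c0_sum I X)" by (rule c0_sum_normed[of I X, OF X])
  show "strongly_proximinal (common_kernel (c0_sum I X) F) (c0_sum I X)"
  proof (rule strongly_proximinalI[OF C common_kernel_closed[OF C Fd]], goal_cases)
    case (1 x y)
    show ?case
      by (rule minimizing_subsequence_near_metric_proj[of I X F J x y]) (fact X F Fd J zero sp 1)+
  qed
qed

end
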